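(* Let $G$ be a unimodular, locally compact, second countable group with a fixed Haar measure $\ell$, and let $\lambda$ be a $\sigma$-finite Borel measure on $\mathrm{Sub}_G$ such that $\lambda$-a.e. $H\in\mathrm{Sub}_G$ is discrete or compact. Then $\lambda$ is conjugation invariant if and only if for every nonnegative Borel function $f:\mathrm{Cos}_G\to\mathbb{R}$, $$\int_{\mathrm{Sub}_G}\int_{H\backslash G}f(Hg)\,d\nu_H(Hg)\,d\lambda(H)=\int_{\mathrm{Sub}_G}\int_{H\backslash G}f(g^{-1}H)\,d\nu_H(Hg)\,d\lambda(H).$$
   Context: Topological groups are Hausdorff. $\mathrm{Sub}_G$ is the space of closed subgroups of $G$ with the Chabauty topology, on which $G$ acts by conjugation $H\mapsto kHk^{-1}$. $\mathrm{Cos}_G=\{Hg: H\in\mathrm{Sub}_G,\ g\in G\}$ is the space of cosets of closed subgroups of $G$ (since $gH=(gHg^{-1})g$, left cosets and right cosets give the same set), with the Fell topology of closed subsets of $G$, i.e. the topology with subbasis $\{C:C\cap K=\emptyset\}$ ($K\subset G$ compact) and $\{C:C\cap U\ne\emptyset\}$ ($U\subset G$ open); its restriction to subgroups is the Chabauty topology. The measures $\nu_H$ on $H\backslash G\subset\mathrm{Cos}_G$ are defined as follows. If $H$ is compact, $\nu_H$ is the push forward of $\ell$ under $G\to H\backslash G$. If $H$ is discrete, $\nu_H$ is the local push forward of $\ell$ under the covering map $G\to H\backslash G$: if $U\subset H\backslash G$ is an evenly covered open set with preimage $V_1\sqcup V_2\sqcup\cdots$, then $\nu_H|_U$ is the push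 forward of $\ell|_{V_i}$ for every $i$; equivalently, it is the unique measure with $\ell=\int_{H\backslash G}\eta_{Hg}\,d\nu_H(Hg)$, where $\eta_{Hg}$ is the counting measure on $Hg$. For finite $H$ the two definitions differ by the factor $|H|$; one of the two conventions is fixed and used for all finite $H$. *)

theory Defs
  imports "HOL-Analysis.Analysis"
begin

text \<open>
  Groups are written additively, because the library class of (not necessarily commutative)
  topological groups is \<open>topological_group_add\<close>: \<open>g h\<close> becomes \<open>g + h\<close>, \<open>g\<inverse>\<close> becomes \<open>- g\<close>
  and \<open>k h k\<inverse>\<close> becomes \<open>k + h - k\<close>. Nothing here assumes that \<open>+\<close> commutes.
\<close>

section \<open>Haar measure\<close>

text \<open>
  No regularity is required: on a locally compact, second countable Hausdorff space every
  Borel measure that is finite on compact sets is regular.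
\<close>

definition left_haar_measure :: "'a::{topological_group_add, t2_space} measure \<Rightarrow> bool" where
  "left_haar_measure l \<longleftrightarrow>
     sets l = sets borel \<and>
     (\<forall>K. compact K \<longrightarrow> emeasure l K < \<infinity>) \<and>
     emeasure l UNIV \<noteq> 0 \<and>
     (\<forall>g. \<forall>A\<in>sets borel. emeasure l ((\<lambda>x. g + x) ` A) = emeasure l A)"

definition unimodular_group :: "'a::{topological_group_add, t2_space} itself \<Rightarrow> bool" where
  "unimodular_group _ \<longleftrightarrow>
     (\<forall>l :: 'a measure. left_haar_measure l \<longrightarrow>
        (\<forall>g. \<forall>A\<in>sets borel. emeasure l ((\<lambda>x. x + g) ` A) = emeasure l A))"


section \<open>Closed subgroups and their cosets\<close>

definition Sub :: "'a::topological_group_add set set" where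
  "Sub = {H. closed H \<and> 0 \<in> H \<and> (\<forall>x\<in>H. \<forall>y\<in>H. x + y \<in> H) \<and> (\<forall>x\<in>H. - x \<in> H)}"

definition right_coset :: "'a::topological_group_add set \<Rightarrow> 'a \<Rightarrow> 'a set" where
  "right_coset H g = (\<lambda>h. h + g) ` H"

definition left_coset :: "'a::topological_group_add \<Rightarrow> 'a set \<Rightarrow> 'a set" where
  "left_coset g H = (\<lambda>h. g + h) ` H"

definition conjugate :: "'a::topological_group_add \<Rightarrow> 'a set \<Rightarrow> 'a set" where
  "conjugate k H = (\<lambda>h. k + h - k) ` H"

definition Cos :: "'a::topological_group_add set set" where
  "Cos = {right_coset H g |H g. H \<in> Sub}"

definition right_cosets :: "'a::topological_group_add set \<Rightarrow> 'a set set" where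
  "right_cosets H = range (right_coset H)"

text \<open>
  The map \<open>H g \<mapsto> g\<inverse> H\<close> is pointwise inversion of cosets, so it does not depend on the
  representative \<open>g\<close>.
\<close>

definition inverse_coset :: "'a::topological_group_add set \<Rightarrow> 'a set" where
  "inverse_coset C = uminus ` C"

lemma inverse_coset_right_coset:
  assumes "H \<in> Sub"
  shows "inverse_coset (right_coset H g) = left_coset (- g) H"
proof -
  have H: "uminus ` H = H"
    using assms by (force simp: Sub_def image_iff intro: bexI[of _ "- x" for x])
  have "inverse_coset (right_coset H g) = (\<lambda>h. - g + h) ` (uminus ` H)"
    by (simp add: inverse_coset_def right_coset_def image_image minus_add)
  then show ?thesis
    by (simp only: H left_coset_def)
qed


section \<open>Fell and Chabauty topologies\<close>

definition fell_topology :: "'a::topological_space set topology" where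
  "fell_topology = topology_generated_by
     ({{C. closed C \<and> C \<inter> K = {}} |K. compact K} \<union>
      {{C. closed C \<and> C \<inter> U \<noteq> {}} |U. open U})"

definition chabauty_topology :: "'a::topological_group_add set topology" where
  "chabauty_topology = subtopology fell_topology Sub"

definition cos_topology :: "'a::topological_group_add set topology" where
  "cos_topology = subtopology fell_topology Cos"

definition right_cosets_topology :: "'a::topological_group_add set \<Rightarrow> 'a set topology" where
  "right_cosets_topology H = subtopology fell_topology (right_cosets H)"

definition borel_of :: "'a topology \<Rightarrow> 'a measure" where
  "borel_of X = sigma (topspace X) {U. openin X U}"

lemma topspace_fell_topology: "topspace fell_topology = {C. closed C}"
proof -
  have "{C::'a set. closed C} \<in> {{C. closed C \<and> C \<inter> K = {}} |K. compact K}"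
    by (rule CollectI, rule exI[of _ "{}"]) auto
  then show ?thesis
    unfolding fell_topology_def topology_generated_by_topspace by blast
qed

lemma space_borel_of: "space (borel_of X) = topspace X"
  by (simp add: borel_of_def space_measure_of_conv)

lemma sets_borel_of: "sets (borel_of X) = sigma_sets (topspace X) {U. openin X U}"
  unfolding borel_of_def by (rule sets_measure_of) (auto dest: openin_subset)

lemma space_borel_of_chabauty: "space (borel_of chabauty_topology) = Sub"
  by (auto simp: space_borel_of chabauty_topology_def topspace_fell_topology Sub_def)


section \<open>The measures on coset spaces\<close>

definition evenly_covered_by ::
    "'a::topological_group_add set \<Rightarrow> 'a set set \<Rightarrow> 'a set set \<Rightarrow> bool" where
  "evenly_covered_by H U Vs \<longleftrightarrow>
     openin (right_cosets_topology H) U \<and>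
     pairwise disjnt Vs \<and>
     \<Union> Vs = right_coset H -` U \<and>
     (\<forall>V\<in>Vs. open V \<and>
        homeomorphic_map (top_of_set V) (subtopology (right_cosets_topology H) U) (right_coset H))"

definition local_push_forward ::
    "'a::topological_group_add measure \<Rightarrow> 'a set \<Rightarrow> 'a set measure \<Rightarrow> bool" where
  "local_push_forward l H n \<longleftrightarrow>
     sets n = sets (borel_of (right_cosets_topology H)) \<and>
     (\<forall>U Vs. evenly_covered_by H U Vs \<longrightarrow>
        (\<forall>V\<in>Vs. restrict_space n U =
                 distr (restrict_space l V) (restrict_space n U) (right_coset H)))"

text \<open>
  A finite subgroup is both compact and discrete, and the two recipes for its coset measure
  differ by the factor \<open>card H\<close>. A value of the following type selects the recipe used for
  all finite subgroups.
\<close>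

datatype finite_convention = Finite_As_Compact | Finite_As_Discrete

text \<open>
  Subgroups that are neither compact nor discrete get a dummy value.
\<close>

definition coset_measure ::
    "finite_convention \<Rightarrow> 'a::topological_group_add measure \<Rightarrow> 'a set \<Rightarrow> 'a set measure" where
  "coset_measure c l H =
     (if compact H \<and> (discrete H \<longrightarrow> c = Finite_As_Compact)
      then distr l (borel_of (right_cosets_topology H)) (right_coset H)
      else if discrete H then (THE n. local_push_forward l H n)
      else null_measure (borel_of (right_cosets_topology H)))"

definition conjugation_invariant :: "'a::topological_group_add set measure \<Rightarrow> bool" where
  "conjugation_invariant lam \<longleftrightarrow> (\<forall>k. distr lam lam (conjugate k) = lam)"

end

theory Submission
  imports Defs
begin

text \<open>
  The key is to write every coset measure as an integral over the group,
  \<open>\<integral> F d\<nu>\<^sub>H = \<integral> w(g) F(H + g) dl(g)\<close>, where \<open>w\<close> is any weight for \<open>H\<close>: the constant \<open>1\<close> in the compact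
  case, and any nonnegative Borel function with \<open>\<Sum>h\<in>H. w(h + g) = 1\<close> for all \<open>g\<close> in the discrete case
  (\<open>nn_integral_coset_measure\<close>). For discrete \<open>H\<close> the push forward of
  \<open>w l\<close> is the local push forward of \<open>l\<close>, by unfolding. The integral does not depend on the weight
  used, and there is
  a weight that is measurable in \<open>H\<close> and \<open>g\<close> together (\<open>transversal_weight\<close>), so Tonelli's theorem applies
  to the double integrals of the theorem.

  Suppose that \<open>lam\<close> is conjugation invariant, and substitute \<open>K = - g + H + g\<close> and then \<open>- g\<close> for \<open>g\<close> in the
  integral of \<open>F(- g + H)\<close>. The second substitution preserves Haar measure because the group is
  unimodular. The result is an integral of \<open>F(K + g)\<close> against \<open>W (- g + K + g) (- g)\<close>. This is a new
  weight for \<open>K\<close>, so it computes the same integral as the old one (\<open>inversion_identity\<close>).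

  Conversely, let \<open>m\<close> be the measure \<open>\<integral> \<nu>\<^sub>H dlam\<close> on cosets. Right translates of weights are weights, so \<open>m\<close> is
  invariant under right translations, and the identity says that it is invariant under inversion.
  Together these give invariance under left translations. A left translation by \<open>k\<close> sends \<open>H + g\<close> to
  \<open>(k + H - k) + (k + g)\<close>, that is, it conjugates the subgroup \<open>H = C - C\<close> that a coset \<open>C\<close> determines.
  It remains to recover \<open>lam\<close> from \<open>m\<close>. The cosets of \<open>H\<close> that meet a fixed relatively compact
  open set of positive measure have a \<open>\<nu>\<^sub>H\<close>-mass that is neither \<open>0\<close> nor infinite; dividing by it
  gives a function on cosets with \<open>\<nu>\<^sub>H\<close>-integral \<open>1\<close> for almost every \<open>H\<close> (\<open>nn_integral_detector\<close>).

  Measurability rests on the fact that the Borel sets of the Fell topology are generated by the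
  conditions that a closed set meets an open set \<open>U\<close> (\<open>measurable_fell_borel\<close>).
\<close>

section \<open>The Borel structure of the Fell topology\<close>

definition basic_open :: "nat \<Rightarrow> 'a::second_countable_topology set" where
  "basic_open = from_nat_into (SOME B. countable B \<and> topological_basis B)"

lemma basic_open:
  shows open_basic_open: "open (basic_open n :: 'a::second_countable_topology set)"
    and basic_open_nhds: "open U \<Longrightarrow> x \<in> U \<Longrightarrow> \<exists>n. x \<in> basic_open n \<and> basic_open n \<subseteq> (U :: 'a set)"
proof -
  define B :: "'a set set" where "B = (SOME B. countable B \<and> topological_basis B)"
  have B: "countable B" "topological_basis B"
    using someI_ex[OF ex_countable_basis[where 'a='a]] unfolding B_def by auto
  have ne: "B \<noteq> {}"
    using topological_basisE[OF B(2) open_UNIV, of undefined] by auto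
  have eq: "basic_open = from_nat_into B"
    by (simp add: basic_open_def B_def)
  show "open (basic_open n :: 'a set)"
    unfolding eq by (rule topological_basis_open[OF B(2)]) (rule from_nat_into[OF ne])
  show "\<exists>n. x \<in> basic_open n \<and> basic_open n \<subseteq> U" if U: "open U" "x \<in> U"
  proof -
    obtain V where V: "V \<in> B" "x \<in> V" "V \<subseteq> U"
      using topological_basisE[OF B(2) U] by blast
    then show ?thesis
      using from_nat_into_surj[OF B(1) V(1)] by (auto simp: eq)
  qed
qed

lemma open_eq_Union_basic_open:
  assumes "open U"
  shows "U = (\<Union>n\<in>{n. basic_open n \<subseteq> U}. basic_open n)"
  using basic_open_nhds[OF assms] by blast

abbreviation fell_borel :: "'a::topological_space set set \<Rightarrow> 'a set measure" where
  "fell_borel S \<equiv> borel_of (subtopology fell_topology S)"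

lemma space_fell_borel: "(\<And>C. C \<in> S \<Longrightarrow> closed C) \<Longrightarrow> space (fell_borel S) = S"
  by (auto simp: space_borel_of topspace_fell_topology)

text \<open>
  Finitely many conditions of the form ``misses this basic open set'' or ``meets this basic open
  set''. There are only countably many such lists of conditions, which is why they are stated
  for indices of a fixed countable basis.
\<close>

definition misses_and_meets :: "nat set \<Rightarrow> nat set \<Rightarrow> 'a::second_countable_topology set \<Rightarrow> bool" where
  "misses_and_meets I J C \<longleftrightarrow> (\<forall>i\<in>I. C \<inter> basic_open i = {}) \<and> (\<forall>j\<in>J. C \<inter> basic_open j \<noteq> {})"

text \<open>
  A closed set that misses a compact \<open>K\<close> also misses a finite union of basic open sets covering
  \<open>K\<close>, and missing that union forces missing \<open>K\<close>. Hence inside every Fell open set each point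
  is surrounded by one of countably many hit-and-miss sets. These need not be Fell open, but they
  lie in the \<open>\<sigma>\<close>-algebra generated by the conditions \<open>C \<inter> U \<noteq> {}\<close> alone.
\<close>

lemma fell_open_finite_conditions:
  fixes T :: "'a::second_countable_topology set set"
  assumes "openin fell_topology T" "C0 \<in> T"
  shows "\<exists>I J. finite I \<and> finite J \<and> misses_and_meets I J C0 \<and>
     (\<forall>C. closed C \<longrightarrow> misses_and_meets I J C \<longrightarrow> C \<in> T)"
  using assms(1)[unfolded fell_topology_def openin_topology_generated_by_iff] assms(2)
proof induction
  case (Int a b)
  have "C0 \<in> a" "C0 \<in> b" using Int.prems by auto
  from Int.IH(1)[OF this(1)] Int.IH(2)[OF this(2)] obtain I J I' J' where
    1: "finite I" "finite J" "misses_and_meets I J C0" "\<forall>C. closed C \<longrightarrow> misses_and_meets I J C \<longrightarrow> C \<in> a" and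
    2: "finite I'" "finite J'" "misses_and_meets I' J' C0" "\<forall>C. closed C \<longrightarrow> misses_and_meets I' J' C \<longrightarrow> C \<in> b"
    by (elim exE conjE)
  have "misses_and_meets (I \<union> I') (J \<union> J') C \<longleftrightarrow> misses_and_meets I J C \<and> misses_and_meets I' J' C" for C :: "'a set"
    by (auto simp only: misses_and_meets_def ball_Un)
  then show ?case
    using 1 2 by - (rule exI[of _ "I \<union> I'"], rule exI[of _ "J \<union> J'"], simp)
next
  case (UN K)
  then obtain k where k: "k \<in> K" "C0 \<in> k" by auto
  from UN.IH[OF this] obtain I J where
    "finite I" "finite J" "misses_and_meets I J C0" "\<forall>C. closed C \<longrightarrow> misses_and_meets I J C \<longrightarrow> C \<in> k"
    by (elim exE conjE)
  then show ?case
    using k(1) by - (rule exI[of _ I], rule exI[of _ J], auto)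
next
  case (Basis s)
  then have "(\<exists>K. compact K \<and> s = {C. closed C \<and> C \<inter> K = {}}) \<or> (\<exists>U. open U \<and> s = {C. closed C \<and> C \<inter> U \<noteq> {}})"
    by (simp only: Un_iff mem_Collect_eq conj_commute)
  then show ?case
  proof (elim disjE exE conjE)
    fix K assume K: "compact K" "s = {C. closed C \<and> C \<inter> K = {}}"
    have C0: "closed C0" "C0 \<inter> K = {}" using Basis K by auto
    then have "open (- C0)" "K \<subseteq> - C0" by auto
    then have "K \<subseteq> (\<Union>n\<in>{n. basic_open n \<subseteq> - C0}. basic_open n)"
      using open_eq_Union_basic_open by blast
    then obtain I where "I \<subseteq> {n. basic_open n \<subseteq> - C0}" "finite I" "K \<subseteq> (\<Union>n\<in>I. basic_open n)"
      by (rule compactE_image[OF K(1) open_basic_open]) auto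
    then show ?thesis
      by - (rule exI[of _ I], rule exI[of _ "{}"], simp add: K(2) misses_and_meets_def, blast)
  next
    fix U assume U: "open U" "s = {C. closed C \<and> C \<inter> U \<noteq> {}}"
    then obtain x where "x \<in> C0" "x \<in> U" using Basis by auto
    then obtain n where "x \<in> basic_open n" "basic_open n \<subseteq> U" using basic_open_nhds[OF U(1)] by blast
    then show ?thesis using \<open>x \<in> C0\<close>
      by - (rule exI[of _ "{}"], rule exI[of _ "{n}"], (auto simp: U(2) misses_and_meets_def))
  qed
qed simp

lemma open_fell_hits: "open U \<Longrightarrow> openin (subtopology fell_topology S) {C\<in>S. closed C \<and> C \<inter> U \<noteq> {}}"
  unfolding fell_topology_def openin_subtopology
  by (rule exI[of _ "{C. closed C \<and> C \<inter> U \<noteq> {}}"]) (auto intro!: topology_generated_by_Basis)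

lemma sets_fell_borel_hits:
  assumes "\<And>C. C \<in> S \<Longrightarrow> closed C" "open U"
  shows "{C\<in>S. C \<inter> U \<noteq> {}} \<in> sets (fell_borel S)"
proof -
  have "{C\<in>S. C \<inter> U \<noteq> {}} = {C\<in>S. closed C \<and> C \<inter> U \<noteq> {}}" using assms by auto
  then show ?thesis
    unfolding sets_borel_of using open_fell_hits[OF assms(2), of S] by auto
qed

text \<open>
  Every Fell open set is a countable union of hit-and-miss sets by
  \<open>fell_open_finite_conditions\<close>, so measurability into a space of closed sets has to be tested on
  the hit sets only. All measurability statements about cosets below go through this test, because
  the condition that \<open>H + g\<close>, \<open>- C\<close> or \<open>C - C\<close> meets \<open>U\<close> is easy to decompose,
  whereas the condition that it misses a compact set is not.
\<close>

lemma measurable_fell_borel: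
  fixes f :: "'b \<Rightarrow> 'a::second_countable_topology set"
  assumes S: "\<And>C. C \<in> S \<Longrightarrow> closed C"
    and f: "\<And>x. x \<in> space M \<Longrightarrow> f x \<in> S"
    and hits: "\<And>U. open U \<Longrightarrow> {x\<in>space M. f x \<inter> U \<noteq> {}} \<in> sets M"
  shows "f \<in> measurable M (fell_borel S)"
proof (rule measurable_sigma_sets[OF sets_borel_of])
  have top: "topspace (subtopology fell_topology S) = S"
    using S by (auto simp: topspace_fell_topology)
  show "{U. openin (subtopology fell_topology S) U} \<subseteq> Pow (topspace (subtopology fell_topology S))"
    using openin_subset by blast
  show "f \<in> space M \<rightarrow> topspace (subtopology fell_topology S)"
    unfolding top using f by auto
  fix T' assume "T' \<in> {U. openin (subtopology fell_topology S) U}"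
  then obtain T where T: "openin fell_topology T" "T' = T \<inter> S"
    by (auto simp: openin_subtopology)
  define N where "N = {(I, J). finite I \<and> finite J \<and> (\<forall>C. closed C \<longrightarrow> misses_and_meets I J C \<longrightarrow> C \<in> T)}"
  have "countable ({I::nat set. finite I} \<times> {J::nat set. finite J})"
    by (intro countable_SIGMA countable_Collect_finite)
  then have N: "countable N"
    by (rule countable_subset[rotated]) (auto simp: N_def)
  have eq: "f -` T' \<inter> space M = (\<Union>IJ\<in>N. {x\<in>space M. misses_and_meets (fst IJ) (snd IJ) (f x)})"
  proof (intro equalityI subsetI)
    fix x assume x: "x \<in> f -` T' \<inter> space M"
    then have "f x \<in> T" using T by auto
    from fell_open_finite_conditions[OF T(1) this] obtain I J where
      "(I, J) \<in> N" "misses_and_meets I J (f x)"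
      by (auto simp: N_def)
    then show "x \<in> (\<Union>IJ\<in>N. {x\<in>space M. misses_and_meets (fst IJ) (snd IJ) (f x)})"
      using x by force
  next
    fix x assume "x \<in> (\<Union>IJ\<in>N. {x\<in>space M. misses_and_meets (fst IJ) (snd IJ) (f x)})"
    then obtain I J where "(I, J) \<in> N" "misses_and_meets I J (f x)" "x \<in> space M" by auto
    then show "x \<in> f -` T' \<inter> space M"
      using f S T by (auto simp: N_def)
  qed
  have basic: "{x\<in>space M. f x \<inter> basic_open i \<noteq> {}} \<in> sets M" for i
    by (rule hits[OF open_basic_open])
  have missed: "{x\<in>space M. f x \<inter> basic_open i = {}} \<in> sets M" for i
    using sets.sets_Collect_neg[OF basic[of i]] by simp
  have "{x\<in>space M. misses_and_meets (fst IJ) (snd IJ) (f x)} \<in> sets M" if IJ: "IJ \<in> N" for IJ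
  proof -
    have "{x\<in>space M. misses_and_meets (fst IJ) (snd IJ) (f x)} =
        {x\<in>space M. (\<forall>i\<in>fst IJ. f x \<inter> basic_open i = {}) \<and> (\<forall>j\<in>snd IJ. f x \<inter> basic_open j \<noteq> {})}"
      by (simp add: misses_and_meets_def)
    also have "\<dots> \<in> sets M"
      using IJ basic missed
      by (intro sets.sets_Collect sets.sets_Collect_countable_Ball) (auto simp: countable_finite N_def)
    finally show ?thesis .
  qed
  then show "f -` T' \<inter> space M \<in> sets M"
    unfolding eq using N by (intro sets.countable_UN') auto
qed

section \<open>Cosets and conjugates\<close>

lemma
  assumes "H \<in> Sub"
  shows Sub_closed: "closed H" and Sub_zero: "0 \<in> H"
    and Sub_add: "x \<in> H \<Longrightarrow> y \<in> H \<Longrightarrow> x + y \<in> H" and Sub_uminus: "x \<in> H \<Longrightarrow> - x \<in> H"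
    and Sub_diff: "x \<in> H \<Longrightarrow> y \<in> H \<Longrightarrow> x - y \<in> H"
  using assms by (auto simp: Sub_def diff_conv_add_uminus simp del: add_uminus_conv_diff)

lemma mem_right_coset: "x \<in> right_coset H g \<longleftrightarrow> x - g \<in> H"
  by (auto simp: right_coset_def image_iff intro: bexI[of _ "x - g"])

lemma mem_left_coset: "x \<in> left_coset k C \<longleftrightarrow> - k + x \<in> C"
  by (auto simp: left_coset_def image_iff intro: bexI[of _ "- k + x"])

lemma mem_inverse_coset: "x \<in> inverse_coset C \<longleftrightarrow> - x \<in> C"
  by (auto simp: inverse_coset_def image_iff intro: bexI[of _ "- x"])

lemma mem_conjugate: "x \<in> conjugate k H \<longleftrightarrow> - k + x + k \<in> H"
proof
  assume "x \<in> conjugate k H"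
  then show "- k + x + k \<in> H"
    by (auto simp: conjugate_def diff_conv_add_uminus add.assoc simp del: add_uminus_conv_diff)
next
  assume "- k + x + k \<in> H"
  then have "k + (- k + x + k) - k \<in> conjugate k H"
    unfolding conjugate_def by (rule imageI)
  then show "x \<in> conjugate k H"
    by (simp add: diff_conv_add_uminus add.assoc del: add_uminus_conv_diff)
qed

lemma conjugate_conjugate: "conjugate k (conjugate m H) = conjugate (k + m) H"
  by (auto simp: mem_conjugate minus_add add.assoc simp del: add_uminus_conv_diff)

lemma conjugate_0 [simp]: "conjugate 0 H = H"
  by (auto simp: mem_conjugate)

lemma continuous_translate_conjugate:
  "continuous_on UNIV (\<lambda>x :: 'a::topological_group_add. k + x + m)"
  "continuous_on UNIV (\<lambda>x :: 'a::topological_group_add. k + x)"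
  "continuous_on UNIV (\<lambda>x :: 'a::topological_group_add. x + k)"
  "continuous_on UNIV (\<lambda>x :: 'a::topological_group_add. x - k)"
  "continuous_on UNIV (\<lambda>x :: 'a::topological_group_add. - x)"
  by (intro continuous_intros)+

lemma conjugate_in_Sub:
  assumes "H \<in> Sub"
  shows "conjugate k H \<in> Sub"
proof -
  have "conjugate k H = (\<lambda>x. - k + x + k) -` H"
    by (auto simp: mem_conjugate)
  then have "closed (conjugate k H)"
    using closed_vimage[OF Sub_closed[OF assms] continuous_translate_conjugate(1)] by simp
  moreover have "- k + (x + y) + k \<in> H" if "- k + x + k \<in> H" "- k + y + k \<in> H" for x y
    using Sub_add[OF assms that] by (simp add: add.assoc)
  moreover have "- k + - x + k \<in> H" if "- k + x + k \<in> H" for x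
    using Sub_uminus[OF assms that] by (simp add: minus_add add.assoc)
  ultimately show ?thesis
    using Sub_zero[OF assms] by (simp add: Sub_def mem_conjugate)
qed

lemma right_coset_in_Cos: "H \<in> Sub \<Longrightarrow> right_coset H g \<in> Cos"
  by (auto simp: Cos_def)

lemma right_cosets_subset_Cos: "H \<in> Sub \<Longrightarrow> right_cosets H \<subseteq> Cos"
  by (auto simp: right_cosets_def Cos_def)

lemma inverse_right_coset:
  assumes "H \<in> Sub"
  shows "inverse_coset (right_coset H g) = right_coset (conjugate (- g) H) (- g)"
proof -
  have "- x - g \<in> H \<longleftrightarrow> g + x \<in> H" for x
    using Sub_uminus[OF assms, of "- x - g"] Sub_uminus[OF assms, of "g + x"]
    by (auto simp: minus_add minus_diff_eq)
  then show ?thesis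
    by (auto simp: mem_inverse_coset mem_right_coset mem_conjugate diff_conv_add_uminus add.assoc simp del: add_uminus_conv_diff)
qed

lemma left_coset_right_coset:
  "left_coset k (right_coset H g) = right_coset (conjugate k H) (k + g)"
  by (auto simp: mem_left_coset mem_right_coset mem_conjugate diff_conv_add_uminus minus_add add.assoc simp del: add_uminus_conv_diff)

lemma left_coset_inverse_coset:
  "left_coset k (inverse_coset (right_coset H g)) = inverse_coset (right_coset H (g - k))"
  by (auto simp: mem_left_coset mem_right_coset mem_inverse_coset diff_conv_add_uminus minus_add add.assoc simp del: add_uminus_conv_diff)

lemma CosE:
  assumes "C \<in> Cos" obtains H g where "H \<in> Sub" "C = right_coset H g"
  using assms by (auto simp: Cos_def)

lemma closed_Cos: "C \<in> Cos \<Longrightarrow> closed C"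
proof (elim CosE)
  fix H g assume H: "H \<in> Sub" "C = right_coset H g"
  then have "C = (\<lambda>x. x - g) -` H"
    by (auto simp: mem_right_coset)
  then show "closed C"
    using closed_vimage[OF Sub_closed[OF H(1)] continuous_translate_conjugate(4)] by simp
qed

lemma inverse_coset_in_Cos: "C \<in> Cos \<Longrightarrow> inverse_coset C \<in> Cos"
  by (elim CosE) (simp add: inverse_right_coset right_coset_in_Cos conjugate_in_Sub)

lemma left_coset_in_Cos: "C \<in> Cos \<Longrightarrow> left_coset k C \<in> Cos"
  by (elim CosE) (simp add: left_coset_right_coset right_coset_in_Cos conjugate_in_Sub)

text \<open>
  The set \<open>C - C\<close> recovers \<open>H\<close> from a coset \<open>C = H + g\<close>, and recovers \<open>- g + H + g\<close> from the
  inverse coset. It is the Borel map \<open>Cos \<rightarrow> Sub\<close> that makes subgroups visible to functions of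
  cosets.
\<close>

definition differences :: "'a::topological_group_add set \<Rightarrow> 'a set" where
  "differences C = {x - y |x y. x \<in> C \<and> y \<in> C}"

lemma differences_right_coset:
  assumes "H \<in> Sub"
  shows "differences (right_coset H g) = H"
proof (intro equalityI subsetI)
  fix z assume "z \<in> differences (right_coset H g)"
  then obtain x y where "z = x - y" "x - g \<in> H" "y - g \<in> H"
    by (auto simp: differences_def mem_right_coset)
  then show "z \<in> H"
    using Sub_diff[OF assms, of "x - g" "y - g"]
    by (simp add: diff_conv_add_uminus minus_add add.assoc del: add_uminus_conv_diff)
next
  fix z assume "z \<in> H"
  then have "z + g \<in> right_coset H g" "g \<in> right_coset H g"
    using Sub_zero[OF assms] by (simp_all add: mem_right_coset)
  then have "(z + g) - g \<in> differences (right_coset H g)"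
    unfolding differences_def by blast
  then show "z \<in> differences (right_coset H g)"
    by simp
qed

lemma differences_in_Sub: "C \<in> Cos \<Longrightarrow> differences C \<in> Sub"
  by (elim CosE) (simp add: differences_right_coset)

lemma differences_inverse_right_coset:
  "H \<in> Sub \<Longrightarrow> differences (inverse_coset (right_coset H g)) = conjugate (- g) H"
  by (simp add: inverse_right_coset differences_right_coset conjugate_in_Sub)

section \<open>Measurability of the operations on cosets\<close>

lemma fell_borel_Sub: "fell_borel Sub = borel_of chabauty_topology"
  and fell_borel_Cos: "fell_borel Cos = borel_of cos_topology"
  and fell_borel_right_cosets: "fell_borel (right_cosets H) = borel_of (right_cosets_topology H)"
  by (simp_all add: chabauty_topology_def cos_topology_def right_cosets_topology_def)

lemma space_fell_borel_Sub [simp]: "space (fell_borel Sub) = Sub"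
  and space_fell_borel_Cos [simp]: "space (fell_borel Cos) = Cos"
  by (auto intro!: space_fell_borel simp: Sub_closed closed_Cos)

lemma space_fell_borel_right_cosets: "H \<in> Sub \<Longrightarrow> space (fell_borel (right_cosets H)) = right_cosets H"
  using right_cosets_subset_Cos by (intro space_fell_borel closed_Cos) auto

lemma borel_measurable_group_uminus [measurable]:
  "uminus \<in> borel_measurable (borel :: 'a::topological_group_add measure)"
  by (rule borel_measurable_continuous_onI[OF continuous_translate_conjugate(5)])

lemma measurable_fell_borel_mono:
  fixes S :: "'a::second_countable_topology set set"
  assumes "S \<subseteq> T" "\<And>C. C \<in> T \<Longrightarrow> closed C"
  shows "(\<lambda>C. C) \<in> measurable (fell_borel S) (fell_borel T)"
proof (rule measurable_fell_borel)
  have S: "closed C" if "C \<in> S" for C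
    using assms that by auto
  show "{x \<in> space (fell_borel S). x \<inter> U \<noteq> {}} \<in> sets (fell_borel S)" if "open U" for U
    using sets_fell_borel_hits[OF S that] space_fell_borel[OF S] by simp
  show "C \<in> T" if "C \<in> space (fell_borel S)" for C
    using that assms(1) space_fell_borel[OF S] by auto
qed (use assms in auto)

lemma open_add_basic_open:
  fixes U :: "'a::{topological_monoid_add, second_countable_topology} set"
  assumes "open U" "x + y \<in> U"
  shows "\<exists>m n. x \<in> basic_open m \<and> y \<in> basic_open n \<and> (\<forall>a\<in>basic_open m. \<forall>b\<in>basic_open n. a + b \<in> U)"
proof -
  have "open ((\<lambda>z. fst z + snd z) -` U)"
    by (intro open_vimage assms(1) continuous_intros)
  moreover have "(x, y) \<in> (\<lambda>z. fst z + snd z) -` U"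
    using assms(2) by simp
  ultimately obtain A B where "open A" "open B" "(x, y) \<in> A \<times> B" "A \<times> B \<subseteq> (\<lambda>z. fst z + snd z) -` U"
    by (rule open_prod_elim)
  moreover obtain m n where "x \<in> basic_open m" "basic_open m \<subseteq> A" "y \<in> basic_open n" "basic_open n \<subseteq> B"
    using basic_open_nhds calculation by (metis mem_Sigma_iff)
  ultimately show ?thesis
    by (intro exI[of _ m] exI[of _ n]) fastforce
qed

text \<open>
  If \<open>h + g \<in> U\<close> with \<open>h \<in> H\<close>, continuity of addition gives basic neighbourhoods of \<open>h\<close> and \<open>g\<close>
  whose sum stays in \<open>U\<close>. So the set where \<open>H + g\<close> meets \<open>U\<close> is a countable union of
  rectangles.
\<close>

lemma measurable_right_coset:
  "(\<lambda>(H, g). right_coset H g) \<in>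
    measurable (fell_borel Sub \<Otimes>\<^sub>M borel) (fell_borel Cos :: 'a::{topological_group_add, second_countable_topology} set measure)"
proof (rule measurable_fell_borel)
  fix U :: "'a set" assume U: "open U"
  define I where "I = {(m, n). \<forall>a\<in>(basic_open m :: 'a set). \<forall>b\<in>basic_open n. a + b \<in> U}"
  have "{z \<in> space (fell_borel Sub \<Otimes>\<^sub>M borel). (\<lambda>(H, g). right_coset H g) z \<inter> U \<noteq> {}} =
     (\<Union>(m, n)\<in>I. {H\<in>Sub. H \<inter> basic_open m \<noteq> {}} \<times> basic_open n)"
    (is "?L = ?R")
  proof (intro equalityI subsetI)
    fix z assume "z \<in> ?L"
    then obtain H g h where z: "z = (H, g)" "H \<in> Sub" "h \<in> H" "h + g \<in> U"
      by (auto simp: space_pair_measure right_coset_def)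
    from open_add_basic_open[OF U z(4)] obtain m n where
      "h \<in> basic_open m" "g \<in> basic_open n" "(m, n) \<in> I" by (auto simp: I_def)
    then show "z \<in> ?R" using z by auto
  next
    fix z assume "z \<in> ?R"
    then show "z \<in> ?L"
      by (force simp: space_pair_measure right_coset_def I_def)
  qed
  also have "\<dots> \<in> sets (fell_borel Sub \<Otimes>\<^sub>M borel)"
    by (intro sets.countable_UN')
       (auto intro!: sets_fell_borel_hits Sub_closed open_basic_open pair_measureI borel_open)
  finally show "{z \<in> space (fell_borel Sub \<Otimes>\<^sub>M borel). (\<lambda>(H, g). right_coset H g) z \<inter> U \<noteq> {}}
     \<in> sets (fell_borel Sub \<Otimes>\<^sub>M borel)" .
qed (auto simp: closed_Cos space_pair_measure right_coset_in_Cos)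

lemma open_vimage_right_coset_hits:
  fixes U :: "'a::topological_group_add set"
  assumes "open U"
  shows "open {g. right_coset H g \<inter> U \<noteq> {}}"
proof -
  have "{g. right_coset H g \<inter> U \<noteq> {}} = (\<Union>h\<in>H. (\<lambda>g. h + g) -` U)"
    by (auto simp: right_coset_def)
  also have "open \<dots>"
    by (intro open_UN ballI open_vimage assms continuous_translate_conjugate)
  finally show ?thesis .
qed

lemma measurable_right_coset_fixed:
  fixes H :: "'a::{topological_group_add, second_countable_topology} set"
  assumes "H \<in> Sub"
  shows "right_coset H \<in> measurable borel (fell_borel (right_cosets H))"
  using right_cosets_subset_Cos[OF assms] open_vimage_right_coset_hits
  by (intro measurable_fell_borel) (auto intro!: closed_Cos borel_open simp: right_cosets_def)

lemma measurable_image_fell_borel: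
  fixes F :: "'a::second_countable_topology set \<Rightarrow> 'b::second_countable_topology set"
  assumes S: "\<And>C. C \<in> S \<Longrightarrow> closed C" and T: "\<And>C. C \<in> T \<Longrightarrow> closed C"
    and F: "\<And>C. C \<in> S \<Longrightarrow> F C \<in> T"
    and f: "continuous_on UNIV f" "\<And>C. C \<in> S \<Longrightarrow> F C = f ` C"
  shows "F \<in> measurable (fell_borel S) (fell_borel T)"
proof (rule measurable_fell_borel)
  fix U :: "'b set" assume "open U"
  then have "{C\<in>S. C \<inter> f -` U \<noteq> {}} \<in> sets (fell_borel S)"
    by (intro sets_fell_borel_hits S open_vimage f)
  also have "{C\<in>S. C \<inter> f -` U \<noteq> {}} = {C \<in> space (fell_borel S). F C \<inter> U \<noteq> {}}"
    using f(2) by (fastforce simp: space_fell_borel[OF S])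
  finally show "\<dots> \<in> sets (fell_borel S)" .
qed (use assms in \<open>auto simp: space_fell_borel\<close>)

lemma measurable_inverse_coset:
  "inverse_coset \<in> measurable (fell_borel Cos)
     (fell_borel Cos :: 'a::{topological_group_add, second_countable_topology} set measure)"
  by (rule measurable_image_fell_borel[where f=uminus])
     (simp_all add: closed_Cos inverse_coset_in_Cos continuous_translate_conjugate, simp add: inverse_coset_def)

lemma measurable_left_coset:
  "left_coset k \<in> measurable (fell_borel Cos)
     (fell_borel Cos :: 'a::{topological_group_add, second_countable_topology} set measure)"
  by (rule measurable_image_fell_borel[where f="\<lambda>x. k + x"])
     (simp_all add: closed_Cos left_coset_in_Cos continuous_translate_conjugate, simp add: left_coset_def)

lemma measurable_conjugate_fixed:
  "conjugate k \<in> measurable (fell_borel Sub)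
     (fell_borel Sub :: 'a::{topological_group_add, second_countable_topology} set measure)"
  by (rule measurable_image_fell_borel[where f="\<lambda>x. k + x - k"])
     (simp_all add: Sub_closed conjugate_in_Sub continuous_intros, simp add: conjugate_def)

lemma measurable_differences:
  "differences \<in> measurable (fell_borel Cos)
     (fell_borel Sub :: 'a::{topological_group_add, second_countable_topology} set measure)"
proof (rule measurable_fell_borel)
  fix U :: "'a set" assume U: "open U"
  define I where "I = {(m, n). \<forall>a\<in>(basic_open m :: 'a set). \<forall>b\<in>basic_open n. a + b \<in> U}"
  have open_neg: "open (uminus -` (basic_open n :: 'a set))" for n
    by (rule open_vimage[OF open_basic_open continuous_translate_conjugate(5)])
  have "{C \<in> space (fell_borel Cos). differences C \<inter> U \<noteq> {}} =
     (\<Union>(m, n)\<in>I. {C\<in>Cos. C \<inter> basic_open m \<noteq> {}} \<inter> {C\<in>Cos. C \<inter> uminus -` basic_open n \<noteq> {}})"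
    (is "?L = ?R")
  proof (intro equalityI subsetI)
    fix C assume "C \<in> ?L"
    then obtain x y where C: "C \<in> Cos" "x \<in> C" "y \<in> C" "x + - y \<in> U"
      by (auto simp: differences_def)
    from open_add_basic_open[OF U C(4)] obtain m n where
      "x \<in> basic_open m" "- y \<in> basic_open n" "(m, n) \<in> I" by (auto simp: I_def)
    then show "C \<in> ?R" using C by auto
  next
    fix C assume "C \<in> ?R"
    then obtain m n x y where C: "C \<in> Cos" "(m, n) \<in> I" "x \<in> C" "y \<in> C" "x \<in> basic_open m" "- y \<in> basic_open n"
      by auto
    then have "x - y \<in> U" "x - y \<in> differences C" 
      by (auto simp: I_def differences_def diff_conv_add_uminus simp del: add_uminus_conv_diff)
    then show "C \<in> ?L" using C(1) by auto
  qed
  also have "\<dots> \<in> sets (fell_borel Cos)"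
    by (intro sets.countable_UN')
       (auto intro!: sets_fell_borel_hits closed_Cos open_basic_open open_neg)
  finally show "{C \<in> space (fell_borel Cos). differences C \<inter> U \<noteq> {}} \<in> sets (fell_borel Cos)" .
qed (auto simp: Sub_closed differences_in_Sub)

text \<open>
  Conjugation is jointly measurable because it factors through cosets:
  \<open>(H, g) \<mapsto> H + g \<mapsto> - (H + g) \<mapsto> - g + H + g\<close>, the last map being \<open>C \<mapsto> C - C\<close>.
\<close>

lemma measurable_conjugate_pair:
  "(\<lambda>(H, g). conjugate (- g) H) \<in>
    measurable (fell_borel Sub \<Otimes>\<^sub>M borel) (fell_borel Sub :: 'a::{topological_group_add, second_countable_topology} set measure)"
proof -
  have "(\<lambda>z. differences (inverse_coset ((\<lambda>(H, g). right_coset H g) z))) \<in>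
     measurable (fell_borel Sub \<Otimes>\<^sub>M borel) (fell_borel Sub :: 'a set measure)"
    by (rule measurable_compose[OF measurable_compose[OF measurable_right_coset measurable_inverse_coset] measurable_differences])
  then show ?thesis
    by (rule measurable_cong[THEN iffD1, rotated])
       (auto simp: space_pair_measure differences_inverse_right_coset)
qed

section \<open>Discrete subgroups\<close>

text \<open>
  One isolated point suffices, since translations by elements of \<open>H\<close> carry it to any other.
\<close>

lemma discrete_subgroup_iff:
  assumes "H \<in> Sub"
  shows "discrete H \<longleftrightarrow> (\<exists>U. open U \<and> is_singleton (H \<inter> U))"
proof
  assume "discrete H"
  then obtain T where "open T" "T \<inter> H = {0}"
    using Sub_zero[OF assms] by (auto simp: discrete_def isolated_in_def)
  then show "\<exists>U. open U \<and> is_singleton (H \<inter> U)"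
    by (metis inf_commute is_singletonI)
next
  assume "\<exists>U. open U \<and> is_singleton (H \<inter> U)"
  then obtain U a where U: "open U" "H \<inter> U = {a}"
    by (auto simp: is_singleton_def)
  show "discrete H"
  proof (rule discreteI)
    fix x assume x: "x \<in> H"
    have "y = x" if "y \<in> H" "(a - x) + y \<in> U" for y
    proof -
      have "a \<in> H" using U(2) by auto
      then have "(a - x) + y \<in> H \<inter> U"
        using that x by (intro IntI Sub_add[OF assms] Sub_diff[OF assms])
      then have "(a - x) + y = a" using U(2) by simp
      then have "a + (- x + y) = a + 0"
        by (simp add: diff_conv_add_uminus add.assoc del: add_uminus_conv_diff)
      then have "- x + y = 0"
        by (simp only: add_left_cancel)
      then have "x + (- x + y) = x + 0"
        by (simp only:)
      then show ?thesis
        by simp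
    qed
    then have "((\<lambda>y. (a - x) + y) -` U) \<inter> H = {x}"
      using x U(2) by auto
    then show "x isolated_in H"
      using x open_vimage[OF U(1) continuous_translate_conjugate(2)]
      unfolding isolated_in_def by blast
  qed
qed

lemma discrete_subgroup_iff_basic_open:
  assumes "H \<in> Sub"
  shows "discrete H \<longleftrightarrow> (\<exists>n. is_singleton (H \<inter> basic_open n))"
proof
  assume "discrete H"
  then obtain U a where U: "open U" "H \<inter> U = {a}"
    by (auto simp: discrete_subgroup_iff[OF assms] is_singleton_def)
  then obtain n where "a \<in> basic_open n" "basic_open n \<subseteq> U"
    using basic_open_nhds by blast
  then have "H \<inter> basic_open n = {a}" using U by auto
  then show "\<exists>n. is_singleton (H \<inter> basic_open n)" by (metis is_singletonI)
next
  assume "\<exists>n. is_singleton (H \<inter> basic_open n)"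
  then show "discrete H"
    using discrete_subgroup_iff[OF assms] open_basic_open by blast
qed

lemma discrete_coset_isolated:
  fixes H :: "'a::{topological_group_add, second_countable_topology} set"
  assumes "H \<in> Sub" "discrete H"
  shows "\<exists>n. is_singleton (right_coset H g \<inter> basic_open n)"
proof -
  obtain T where T: "open T" "T \<inter> H = {0}"
    using assms Sub_zero[OF assms(1)] by (auto simp: discrete_def isolated_in_def)
  then have "open ((\<lambda>x. x - g) -` T)" "g \<in> (\<lambda>x. x - g) -` T"
    by (auto intro!: open_vimage continuous_translate_conjugate)
  then obtain n where n: "g \<in> basic_open n" "basic_open n \<subseteq> (\<lambda>x. x - g) -` T"
    using basic_open_nhds by blast
  have "x = g" if "x \<in> right_coset H g" "x \<in> basic_open n" for x
  proof -
    have "x - g \<in> T \<inter> H" using that n by (auto simp: mem_right_coset)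
    then have "x - g = 0" using T(2) by simp
    then show ?thesis by simp
  qed
  moreover have "g \<in> right_coset H g"
    using Sub_zero[OF assms(1)] by (simp add: mem_right_coset)
  ultimately have "right_coset H g \<inter> basic_open n = {g}"
    using n by auto
  then show ?thesis by (metis is_singletonI)
qed

lemma countable_discrete:
  fixes H :: "'a::second_countable_topology set"
  assumes "discrete H"
  shows "countable H"
proof -
  have "\<exists>n. H \<inter> basic_open n = {h}" if "h \<in> H" for h
  proof -
    have "h isolated_in H"
      by (rule discreteD[OF assms that])
    then obtain T where T: "open T" "T \<inter> H = {h}"
      by (auto simp: isolated_in_def)
    then obtain n where "h \<in> basic_open n" "basic_open n \<subseteq> T"
      using basic_open_nhds by blast
    then show ?thesis using T by (intro exI[of _ n]) auto
  qed
  then obtain f where f: "\<And>h. h \<in> H \<Longrightarrow> H \<inter> basic_open (f h) = {h}"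
    by metis
  have "inj_on f H"
    by (rule inj_onI) (metis f singleton_inject)
  then show ?thesis
    by (rule countableI')
qed

lemma discrete_conjugate:
  assumes "H \<in> Sub"
  shows "discrete (conjugate k H) \<longleftrightarrow> discrete H"
proof -
  have *: "discrete (conjugate k H)" if H: "H \<in> Sub" "discrete H" for H :: "'a set" and k
  proof -
    obtain U a where U: "open U" "H \<inter> U = {a}"
      using H by (auto simp: discrete_subgroup_iff is_singleton_def)
    have iff: "x \<in> conjugate k H \<inter> (\<lambda>x. - k + x + k) -` U \<longleftrightarrow> - k + x + k \<in> H \<inter> U" for x
      by (simp add: mem_conjugate)
    have "- k + x + k = a \<longleftrightarrow> x = k + a - k" for x
      by (auto simp: diff_conv_add_uminus add.assoc simp del: add_uminus_conv_diff)
    then have "conjugate k H \<inter> (\<lambda>x. - k + x + k) -` U = {k + a - k}"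
      by (intro set_eqI) (simp only: iff U(2) singleton_iff)
    moreover have "open ((\<lambda>x. - k + x + k) -` U)"
      by (intro open_vimage U continuous_translate_conjugate)
    ultimately show ?thesis
      unfolding discrete_subgroup_iff[OF conjugate_in_Sub[OF H(1)]] by (metis is_singletonI)
  qed
  show ?thesis
    using *[OF assms, of k] *[OF conjugate_in_Sub[OF assms], of k "- k"]
    by (auto simp: conjugate_conjugate)
qed

lemma compact_conjugate: "compact (conjugate k H) \<longleftrightarrow> compact H"
proof -
  have *: "compact (conjugate k H)" if "compact H" for H :: "'a set" and k
    unfolding conjugate_def
    by (intro compact_continuous_image that continuous_intros)
  show ?thesis
    using *[of H k] *[of "conjugate k H" "- k"] by (auto simp: conjugate_conjugate)
qed

text \<open>
  If \<open>T\<close> is a neighbourhood of \<open>0\<close> meeting \<open>H\<close> only in \<open>0\<close>, then a set \<open>V\<close> with \<open>V - V \<subseteq> T\<close> contains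
  at most one point of each coset. Such sets are the sheets of the covering of the coset space.
\<close>

lemma discrete_subgroup_separating_basic_open:
  fixes H :: "'a::{topological_group_add, second_countable_topology} set" and g :: 'a
  assumes "H \<in> Sub" "discrete H"
  shows "\<exists>n. g \<in> basic_open n \<and> (\<forall>x\<in>(basic_open n :: 'a set). \<forall>y\<in>basic_open n. x - y \<in> H \<longrightarrow> x = y)"
proof -
  obtain T where T: "open T" "T \<inter> H = {0}"
    using assms Sub_zero[OF assms(1)] by (auto simp: discrete_def isolated_in_def)
  have "open ((\<lambda>z :: 'a \<times> 'a. fst z - snd z) -` T)"
    by (intro open_vimage T continuous_intros)
  moreover have "(g, g) \<in> (\<lambda>z. fst z - snd z) -` T"
    using T by auto
  ultimately obtain A B where AB: "open A" "open B" "(g, g) \<in> A \<times> B" "A \<times> B \<subseteq> (\<lambda>z. fst z - snd z) -` T"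
    by (rule open_prod_elim)
  then have "open (A \<inter> B)" "g \<in> A \<inter> B" by auto
  then obtain n where n: "g \<in> basic_open n" "basic_open n \<subseteq> A \<inter> B"
    using basic_open_nhds by blast
  have "x = y" if "x \<in> basic_open n" "y \<in> basic_open n" "x - y \<in> H" for x y
  proof -
    have "(x, y) \<in> A \<times> B" using n(2) that by blast
    then have "x - y \<in> T \<inter> H" using AB(4) that(3) by auto
    then have "x - y = 0" using T(2) by simp
    then show ?thesis by simp
  qed
  then show ?thesis using n(1) by blast
qed

section \<open>Borel sets of subgroups\<close>

text \<open>
  By the Hausdorff property, two points of \<open>C\<close> in a basic open set can be separated by two disjoint
  basic open subsets, so having exactly one point there is a countable combination of hit conditions.
\<close>

lemma sets_isolated:
  fixes S :: "'a::{t2_space, second_countable_topology} set set"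
  assumes S: "\<And>C. C \<in> S \<Longrightarrow> closed C"
  shows "{C\<in>S. is_singleton (C \<inter> basic_open n)} \<in> sets (fell_borel S)"
proof -
  define I where "I = {p. basic_open (fst p) \<subseteq> (basic_open n :: 'a set) \<and> basic_open (snd p) \<subseteq> (basic_open n :: 'a set) \<and>
     basic_open (fst p) \<inter> basic_open (snd p) = ({} :: 'a set)}"
  let ?hits = "\<lambda>i. {C\<in>S. C \<inter> basic_open i \<noteq> {}}"
  have "{C\<in>S. is_singleton (C \<inter> basic_open n)} = ?hits n - (\<Union>p\<in>I. ?hits (fst p) \<inter> ?hits (snd p))"
    (is "?L = ?R")
  proof (rule set_eqI)
    fix C :: "'a set"
    have "is_singleton (C \<inter> basic_open n) \<longleftrightarrow> C \<inter> basic_open n \<noteq> {} \<and>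
      (\<forall>p\<in>I. \<not> (C \<inter> basic_open (fst p) \<noteq> {} \<and> C \<inter> basic_open (snd p) \<noteq> {}))"
    proof (intro iffI conjI ballI notI; (elim conjE)?)
      fix p assume single: "is_singleton (C \<inter> basic_open n)" and p: "p \<in> I"
        and "C \<inter> basic_open (fst p) \<noteq> {}" "C \<inter> basic_open (snd p) \<noteq> {}"
      moreover define i j where "i = fst p" and "j = snd p"
      ultimately obtain a b where ab: "a \<in> C" "a \<in> basic_open i" "b \<in> C" "b \<in> basic_open j" by blast
      have sub: "basic_open i \<subseteq> (basic_open n :: 'a set)" "basic_open j \<subseteq> (basic_open n :: 'a set)"
        "basic_open i \<inter> basic_open j = ({} :: 'a set)"
        using p by (simp_all add: I_def i_def j_def)
      have "a \<in> C \<inter> basic_open n" "b \<in> C \<inter> basic_open n"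
        using ab sub(1,2) by (simp_all add: subset_iff)
      moreover obtain x where "C \<inter> basic_open n = {x}"
        using single by (rule is_singletonE)
      ultimately have "a = b"
        by simp
      then show False
        using ab sub(3) by (simp add: disjoint_iff)
    next
      assume "C \<inter> basic_open n \<noteq> {}" and
        sep: "\<forall>p\<in>I. \<not> (C \<inter> basic_open (fst p) \<noteq> {} \<and> C \<inter> basic_open (snd p) \<noteq> {})"
      then obtain x where x: "x \<in> C" "x \<in> basic_open n" by auto
      have "y = x" if y: "y \<in> C" "y \<in> basic_open n" for y
      proof (rule ccontr)
        assume "y \<noteq> x"
        then obtain U V where UV: "open U" "open V" "y \<in> U" "x \<in> V" "U \<inter> V = {}"
          using hausdorff[OF \<open>y \<noteq> x\<close>] by (elim exE conjE)
        have U: "open (U \<inter> basic_open n)" "y \<in> U \<inter> basic_open n"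
          and V: "open (V \<inter> basic_open n)" "x \<in> V \<inter> basic_open n"
          using UV(1-4) y(2) x(2) by (simp_all add: open_basic_open open_Int)
        obtain i where i: "y \<in> basic_open i" "basic_open i \<subseteq> U \<inter> basic_open n"
          using basic_open_nhds[OF U] by (elim exE conjE)
        obtain j where j: "x \<in> basic_open j" "basic_open j \<subseteq> V \<inter> basic_open n"
          using basic_open_nhds[OF V] by (elim exE conjE)
        have "(i, j) \<in> I"
          using UV(5) i(2) j(2) by (auto simp: I_def)
        then have "\<not> (C \<inter> basic_open i \<noteq> {} \<and> C \<inter> basic_open j \<noteq> {})"
          using sep by (metis fst_conv snd_conv)
        then show False using i(1) j(1) x(1) y(1) by auto
      qed
      then have "C \<inter> basic_open n = {x}" using x by blast
      then show "is_singleton (C \<inter> basic_open n)" by simp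
    next
      assume "is_singleton (C \<inter> basic_open n)" "C \<inter> basic_open n = {}"
      then show False by (simp add: is_singleton_def)
    qed
    then show "C \<in> ?L \<longleftrightarrow> C \<in> ?R"
      by (cases "C \<in> S") simp_all
  qed
  also have "\<dots> \<in> sets (fell_borel S)"
    by (intro sets.Diff sets.countable_UN' image_subsetI countableI_type sets.Int sets_fell_borel_hits S open_basic_open)
  finally show ?thesis .
qed

lemma sets_discrete_subgroups:
  "{H\<in>Sub. discrete H} \<in> sets (fell_borel (Sub :: 'a::{topological_group_add, t2_space, second_countable_topology} set set))"
proof -
  have "{H\<in>Sub. discrete H} = (\<Union>n. {H\<in>Sub. is_singleton (H \<inter> (basic_open n :: 'a set))})"
    by (auto simp: discrete_subgroup_iff_basic_open)
  also have "\<dots> \<in> sets (fell_borel Sub)"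
    by (intro sets.countable_UN image_subsetI sets_isolated Sub_closed)
  finally show ?thesis .
qed

lemma relatively_compact_basic_open:
  assumes "locally_compact_space (euclidean :: 'a::{t2_space, second_countable_topology} topology)"
  shows "\<exists>n. (x :: 'a) \<in> basic_open n \<and> compact (closure (basic_open n :: 'a set))"
proof -
  have "\<exists>U K. openin euclidean U \<and> compactin euclidean K \<and> x \<in> U \<and> U \<subseteq> K"
    using assms unfolding locally_compact_space_def by simp
  then obtain U K where "openin euclidean U" "compactin euclidean K" and xU: "x \<in> U" and UK: "U \<subseteq> K"
    by (elim exE conjE)
  then have U: "open U" and K: "compact K"
    by (simp_all add: compactin_euclidean_iff)
  obtain n where n: "x \<in> basic_open n" "basic_open n \<subseteq> U"
    using basic_open_nhds[OF U xU] by (elim exE conjE)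
  have "closure (basic_open n) \<subseteq> K"
    by (rule closure_minimal[OF subset_trans[OF n(2) UK] compact_imp_closed[OF K]])
  then have "compact (K \<inter> closure (basic_open n))" "K \<inter> closure (basic_open n) = closure (basic_open n)"
    by (auto intro: compact_Int_closed K)
  then show ?thesis using n(1) by (intro exI[of _ n]) simp
qed

text \<open>
  A closed subgroup is compact exactly if it lies in one of the countably many compact sets that are
  finite unions of closures of basic open sets; lying in a closed set means missing its open
  complement.
\<close>

lemma sets_compact_subgroups:
  assumes lc: "locally_compact_space (euclidean :: 'a::{topological_group_add, t2_space, second_countable_topology} topology)"
  shows "{H\<in>Sub. compact H} \<in> sets (fell_borel (Sub :: 'a set set))"
proof -
  define N where "N = {n. compact (closure (basic_open n :: 'a set))}"
  define K where "K I = (\<Union>n\<in>I. closure (basic_open n :: 'a set))" for I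
  have K: "compact (K I)" if "finite I" "I \<subseteq> N" for I
    using that by (auto simp: K_def N_def)
  have "countable {I. finite I \<and> I \<subseteq> N}"
    by (rule countable_subset[OF _ countable_Collect_finite]) auto
  moreover have eq: "{H\<in>Sub. compact H} = (\<Union>I\<in>{I. finite I \<and> I \<subseteq> N}. Sub - {H\<in>Sub. H \<inter> - K I \<noteq> {}})"
    (is "?L = ?R")
  proof (intro equalityI subsetI)
    fix H :: "'a set" assume "H \<in> ?L"
    then have H: "H \<in> Sub" "compact H" by auto
    have "H \<subseteq> (\<Union>n\<in>N. basic_open n)"
      using relatively_compact_basic_open[OF lc] unfolding N_def by blast
    then obtain I where I: "I \<subseteq> N" "finite I" "H \<subseteq> (\<Union>n\<in>I. basic_open n)"
      by (rule compactE_image[OF H(2) open_basic_open]) auto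
    have "(\<Union>n\<in>I. basic_open n) \<subseteq> K I"
      unfolding K_def by (intro UN_mono order_refl closure_subset)
    then have "H \<inter> - K I = {}"
      using I(3) by blast
    then show "H \<in> ?R" using I(1,2) H(1) by blast
  next
    fix H :: "'a set" assume "H \<in> ?R"
    then obtain I where I: "H \<in> Sub" "finite I" "I \<subseteq> N" "H \<inter> - K I = {}" by blast
    then have "K I \<inter> H = H" by blast
    then have "compact H"
      using compact_Int_closed[OF K[OF I(2,3)] Sub_closed[OF I(1)]] by simp
    then show "H \<in> ?L" using I by simp
  qed
  moreover have "Sub - {H\<in>Sub. H \<inter> - K I \<noteq> {}} \<in> sets (fell_borel Sub)" if "finite I" "I \<subseteq> N" for I
  proof -
    have "open (- K I)" using K[OF that] by (simp add: compact_imp_closed open_Compl)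
    then have "{H\<in>Sub. H \<inter> - K I \<noteq> {}} \<in> sets (fell_borel Sub)"
      by (intro sets_fell_borel_hits Sub_closed)
    then have "space (fell_borel Sub) - {H\<in>Sub. H \<inter> - K I \<noteq> {}} \<in> sets (fell_borel Sub)"
      by (rule sets.compl_sets)
    then show ?thesis
      by (simp only: space_fell_borel_Sub)
  qed
  ultimately show ?thesis
    unfolding eq by (intro sets.countable_UN') blast+
qed

section \<open>The covering of the coset space of a discrete subgroup\<close>

text \<open>
  The complementary set is the projection of the closed set of all \<open>(k, g)\<close> with \<open>k \<in> K\<close> and
  \<open>k - g \<in> H\<close> along the compact factor \<open>K\<close>, hence closed.
\<close>

lemma open_vimage_right_coset_misses:
  fixes K :: "'a::topological_group_add set"
  assumes "closed H" "compact K"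
  shows "open {g. right_coset H g \<inter> K = {}}"
proof -
  have prod: "prod_topology (top_of_set K) euclidean = (top_of_set (K \<times> UNIV) :: ('a \<times> 'a) topology)"
    by (metis prod_topology_subtopology_eu subtopology_UNIV)
  have "closedin (top_of_set (K \<times> UNIV)) ((K \<times> UNIV) \<inter> (\<lambda>z :: 'a \<times> 'a. fst z - snd z) -` H)"
    by (intro continuous_closedin_preimage assms continuous_intros)
  moreover have "closed_map (top_of_set (K \<times> UNIV)) (euclidean :: 'a topology) snd"
    using closed_map_snd[of "top_of_set K" "euclidean :: 'a topology"] assms(2)
    unfolding prod by (simp add: compact_space_subtopology)
  ultimately have "closed (snd ` ((K \<times> UNIV) \<inter> (\<lambda>z :: 'a \<times> 'a. fst z - snd z) -` H))"
    unfolding closed_map_def by simp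
  moreover have "{g. right_coset H g \<inter> K = {}} = - (snd ` ((K \<times> UNIV) \<inter> (\<lambda>z :: 'a \<times> 'a. fst z - snd z) -` H))"
    by (force simp: mem_right_coset)
  ultimately show ?thesis by (simp add: open_Compl)
qed

lemma continuous_right_coset:
  fixes H :: "'a::topological_group_add set"
  assumes "H \<in> Sub"
  shows "continuous_map euclidean (right_cosets_topology H) (right_coset H)"
proof -
  have "continuous_map euclidean fell_topology (right_coset H)"
    unfolding fell_topology_def
  proof (rule continuous_on_generated_topo)
    fix T :: "'a set set"
    assume "T \<in> {{C. closed C \<and> C \<inter> K = {}} |K. compact K} \<union> {{C. closed C \<and> C \<inter> U \<noteq> {}} |U. open U}"
    then have "(\<exists>K. compact K \<and> T = {C. closed C \<and> C \<inter> K = {}}) \<or> (\<exists>U. open U \<and> T = {C. closed C \<and> C \<inter> U \<noteq> {}})"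
      by (simp only: Un_iff mem_Collect_eq conj_commute)
    then show "openin euclidean (right_coset H -` T \<inter> topspace euclidean)"
      using open_vimage_right_coset_misses[OF Sub_closed[OF assms]] open_vimage_right_coset_hits
        closed_Cos[OF right_coset_in_Cos[OF assms]]
      by (elim disjE exE conjE) (simp_all add: vimage_def)
  next
    show "right_coset H ` topspace euclidean \<subseteq>
      \<Union> ({{C. closed C \<and> C \<inter> K = {}} |K. compact K} \<union> {{C. closed C \<and> C \<inter> U \<noteq> {}} |U. open U})"
      using topspace_fell_topology[where 'a='a] closed_Cos[OF right_coset_in_Cos[OF assms]]
      unfolding fell_topology_def topology_generated_by_topspace by auto
  qed
  then show ?thesis
    by (simp add: right_cosets_topology_def right_cosets_def continuous_map_in_subtopology)
qed

lemma right_coset_eq_iff: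
  assumes "H \<in> Sub"
  shows "right_coset H x = right_coset H y \<longleftrightarrow> x - y \<in> H"
proof
  assume "right_coset H x = right_coset H y"
  then show "x - y \<in> H"
    using Sub_zero[OF assms] by (metis diff_self mem_right_coset)
next
  assume xy: "x - y \<in> H"
  have "z - x \<in> H \<longleftrightarrow> z - y \<in> H" for z
    using Sub_add[OF assms _ xy, of "z - x"] Sub_diff[OF assms _ xy, of "z - y"]
    by (auto simp: diff_conv_add_uminus minus_add add.assoc simp del: add_uminus_conv_diff)
  then show "right_coset H x = right_coset H y"
    by (auto simp: mem_right_coset)
qed

lemma open_image_right_coset:
  assumes "H \<in> Sub" "open V"
  shows "openin (right_cosets_topology H) (right_coset H ` V)"
proof -
  have "right_coset H ` V = {C\<in>right_cosets H. closed C \<and> C \<inter> V \<noteq> {}}"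
  proof (intro equalityI subsetI)
    fix C assume "C \<in> right_coset H ` V"
    then obtain v where v: "v \<in> V" "C = right_coset H v" by auto
    then have "v \<in> C"
      using Sub_zero[OF assms(1)] by (simp add: mem_right_coset)
    then show "C \<in> {C\<in>right_cosets H. closed C \<and> C \<inter> V \<noteq> {}}"
      using v closed_Cos[OF right_coset_in_Cos[OF assms(1)]] by (auto simp: right_cosets_def)
  next
    fix C assume "C \<in> {C\<in>right_cosets H. closed C \<and> C \<inter> V \<noteq> {}}"
    then obtain g v where v: "C = right_coset H g" "v \<in> V" "v \<in> right_coset H g"
      by (auto simp: right_cosets_def)
    then have "C = right_coset H v"
      using right_coset_eq_iff[OF assms(1), of v g] by (simp add: mem_right_coset)
    then show "C \<in> right_coset H ` V" using v by auto
  qed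
  then show ?thesis
    using open_fell_hits[OF assms(2), of "right_cosets H"] by (simp add: right_cosets_topology_def)
qed

lemma topspace_right_cosets_topology: "H \<in> Sub \<Longrightarrow> topspace (right_cosets_topology H) = right_cosets H"
  using space_fell_borel_right_cosets[of H] by (simp add: fell_borel_right_cosets space_borel_of)

text \<open>
  When \<open>V\<close> meets every coset at most once, its translates \<open>h + V\<close> are disjoint, fill the preimage of
  the image of \<open>V\<close>, and are each mapped homeomorphically, because \<open>g \<mapsto> H + g\<close> is continuous and
  open for the Fell topology.
\<close>

lemma evenly_covered_image:
  assumes H: "H \<in> Sub" and V: "open V" and sep: "\<forall>x\<in>V. \<forall>y\<in>V. x - y \<in> H \<longrightarrow> x = y"
  shows "evenly_covered_by H (right_coset H ` V) ((\<lambda>h. (\<lambda>x. h + x) ` V) ` H)"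
  unfolding evenly_covered_by_def
proof (intro conjI ballI)
  let ?sheet = "\<lambda>h. (\<lambda>x. h + x) ` V"
  have shift: "right_coset H (h + x) = right_coset H x" if "h \<in> H" for h x
    using that by (simp add: right_coset_eq_iff[OF H])
  show "openin (right_cosets_topology H) (right_coset H ` V)"
    by (rule open_image_right_coset[OF H V])
  show "pairwise disjnt (?sheet ` H)"
  proof (rule pairwiseI)
    fix A B assume "A \<in> ?sheet ` H" "B \<in> ?sheet ` H" and ne: "A \<noteq> B"
    then obtain h k where hk: "h \<in> H" "k \<in> H" "A = ?sheet h" "B = ?sheet k" by auto
    have "h = k" if "x \<in> V" "y \<in> V" "h + x = k + y" for x y
    proof -
      have "right_coset H x = right_coset H y"
        using shift[OF hk(1), of x] shift[OF hk(2), of y] that(3) by simp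
      then have "x = y" using sep that by (auto simp: right_coset_eq_iff[OF H])
      then show "h = k" using that(3) by simp
    qed
    then show "disjnt A B"
      using ne hk by (auto simp: disjnt_def)
  qed
  show "\<Union> (?sheet ` H) = right_coset H -` right_coset H ` V"
  proof (intro equalityI subsetI)
    fix z assume "z \<in> right_coset H -` right_coset H ` V"
    then obtain v where "v \<in> V" "z - v \<in> H" by (auto simp: right_coset_eq_iff[OF H])
    then have "(z - v) + v \<in> \<Union> (?sheet ` H)" by blast
    then show "z \<in> \<Union> (?sheet ` H)" by simp
  qed (use shift in auto)
  fix W assume "W \<in> ?sheet ` H"
  then obtain h where h: "h \<in> H" "W = ?sheet h" by auto
  have "W = (\<lambda>x. - h + x) -` V"
    unfolding h by (force simp: image_iff)
  then show openW: "open W"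
    by (simp only: open_vimage[OF V continuous_translate_conjugate(2)])
  have image: "right_coset H ` W = right_coset H ` V"
    using shift[OF h(1)] by (simp add: h(2) image_image)
  have sub: "right_coset H ` V \<subseteq> right_cosets H" by (auto simp: right_cosets_def)
  show "homeomorphic_map (top_of_set W) (subtopology (right_cosets_topology H) (right_coset H ` V)) (right_coset H)"
  proof (rule bijective_open_imp_homeomorphic_map)
    show "continuous_map (top_of_set W) (subtopology (right_cosets_topology H) (right_coset H ` V)) (right_coset H)"
      using continuous_map_from_subtopology[OF continuous_right_coset[OF H]] image
      by (auto simp: continuous_map_in_subtopology)
    show "open_map (top_of_set W) (subtopology (right_cosets_topology H) (right_coset H ` V)) (right_coset H)"
      unfolding open_map_def
    proof (intro allI impI)
      fix A assume "openin (top_of_set W) A"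
      then have "open A" "A \<subseteq> W" using openW by (auto simp: openin_open_eq)
      then have "right_coset H ` A = right_coset H ` A \<inter> right_coset H ` V" using image by blast
      then show "openin (subtopology (right_cosets_topology H) (right_coset H ` V)) (right_coset H ` A)"
        using open_image_right_coset[OF H \<open>open A\<close>] unfolding openin_subtopology by blast
    qed
    show "right_coset H ` topspace (top_of_set W) = topspace (subtopology (right_cosets_topology H) (right_coset H ` V))"
      using image sub by (auto simp: topspace_right_cosets_topology[OF H])
    show "inj_on (right_coset H) (topspace (top_of_set W))"
    proof (rule inj_onI)
      fix x y assume xy: "x \<in> topspace (top_of_set W)" "y \<in> topspace (top_of_set W)"
        "right_coset H x = right_coset H y"
      then obtain v w where vw: "v \<in> V" "w \<in> V" "x = h + v" "y = h + w" by (auto simp: h)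
      then have "right_coset H v = right_coset H w" using xy(3) shift[OF h(1)] by simp
      then show "x = y" using sep vw by (auto simp: right_coset_eq_iff[OF H])
    qed
  qed
qed

section \<open>Haar measure on a unimodular group\<close>

lemma borel_measurable_uminus_group [measurable (raw)]:
  fixes f :: "'b \<Rightarrow> 'a::topological_group_add"
  assumes "f \<in> borel_measurable M"
  shows "(\<lambda>x. - f x) \<in> borel_measurable M"
  by (rule measurable_compose[OF assms borel_measurable_group_uminus])

locale unimodular_haar =
  fixes l :: "'a::{topological_group_add, t2_space, second_countable_topology} measure"
  assumes locally_compact: "locally_compact_space (euclidean :: 'a topology)"
    and left_haar: "left_haar_measure l"
    and right_invariant: "A \<in> sets borel \<Longrightarrow> emeasure l ((\<lambda>x. x + g) ` A) = emeasure l A"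
begin

lemma sets_haar [measurable_cong]: "sets l = sets borel"
  using left_haar by (simp add: left_haar_measure_def)

lemma space_haar [simp]: "space l = UNIV"
  using sets_eq_imp_space_eq[OF sets_haar] by simp

lemma finite_relatively_compact:
  assumes "compact (closure U)"
  shows "emeasure l U < \<infinity>"
proof -
  have "emeasure l U \<le> emeasure l (closure U)"
    by (rule emeasure_mono[OF closure_subset]) (simp add: sets_haar)
  also have "\<dots> < \<infinity>"
    using left_haar assms unfolding left_haar_measure_def by blast
  finally show ?thesis .
qed

lemma sigma_finite_haar: "sigma_finite_measure l"
proof
  let ?A = "basic_open ` {n. compact (closure (basic_open n :: 'a set))} :: 'a set set"
  show "\<exists>A. countable A \<and> A \<subseteq> sets l \<and> \<Union>A = space l \<and> (\<forall>a\<in>A. emeasure l a \<noteq> \<infinity>)"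
  proof (intro exI[of _ ?A] conjI ballI)
    show "?A \<subseteq> sets l"
      by (auto simp: sets_haar open_basic_open)
    show "\<Union> ?A = space l"
      using relatively_compact_basic_open[OF locally_compact] by auto
    show "emeasure l a \<noteq> \<infinity>" if "a \<in> ?A" for a
      using that finite_relatively_compact[of a] by auto
  qed simp
qed

text \<open>
  Countably many relatively compact open sets cover the group, and a nonzero measure cannot vanish on
  all of them.
\<close>

lemma ex_window: "\<exists>U. open U \<and> compact (closure U) \<and> emeasure l U \<noteq> 0"
proof (rule ccontr)
  assume *: "\<not> ?thesis"
  have "(\<Union>n\<in>{n. compact (closure (basic_open n :: 'a set))}. basic_open n) \<in> null_sets l"
    using * by (intro null_sets_UN') (auto simp: sets_haar open_basic_open intro!: null_setsI)
  moreover have "(\<Union>n\<in>{n. compact (closure (basic_open n :: 'a set))}. basic_open n) = (UNIV :: 'a set)"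
    using relatively_compact_basic_open[OF locally_compact] by auto
  ultimately show False
    using left_haar by (auto simp: left_haar_measure_def)
qed

text \<open>
  A fixed open set of positive finite measure, against which functions and measures get normalized.
\<close>

definition window :: "'a set" where
  "window = (SOME U. open U \<and> compact (closure U) \<and> emeasure l U \<noteq> 0)"

lemma
  shows open_window: "open window"
    and compact_closure_window: "compact (closure window)"
    and emeasure_window_nonzero: "emeasure l window \<noteq> 0"
    and emeasure_window_finite: "emeasure l window \<noteq> top"
proof -
  have *: "open window \<and> compact (closure window) \<and> emeasure l window \<noteq> 0"
    unfolding window_def by (rule someI_ex[OF ex_window])
  then show "open window" "compact (closure window)" "emeasure l window \<noteq> 0" by auto
  show "emeasure l window \<noteq> top"
    using finite_relatively_compact[of window] * by auto
qed

lemma sets_window [measurable]: "window \<in> sets borel"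
  by (simp add: open_window)

lemma nn_integral_left_translate:
  assumes [measurable]: "f \<in> borel_measurable borel"
  shows "(\<integral>\<^sup>+x. f (k + x) \<partial>l) = (\<integral>\<^sup>+x. f x \<partial>l)"
proof -
  have "distr l l (\<lambda>x. k + x) = l"
  proof (rule measure_eqI)
    fix A assume "A \<in> sets (distr l l (\<lambda>x. k + x))"
    then have A: "A \<in> sets borel" by (simp add: sets_haar)
    have "(\<lambda>x. k + x) -` A = (\<lambda>x. - k + x) ` A"
      by (force simp: image_iff)
    then show "emeasure (distr l l (\<lambda>x. k + x)) A = emeasure l A"
      using A left_haar by (simp add: emeasure_distr sets_haar left_haar_measure_def)
  qed simp
  then have "(\<integral>\<^sup>+x. f x \<partial>l) = (\<integral>\<^sup>+x. f x \<partial>distr l l (\<lambda>x. k + x))" by simp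
  also have "\<dots> = (\<integral>\<^sup>+x. f (k + x) \<partial>l)"
    by (rule nn_integral_distr) measurable
  finally show ?thesis by simp
qed

lemma nn_integral_right_translate:
  assumes [measurable]: "f \<in> borel_measurable borel"
  shows "(\<integral>\<^sup>+x. f (x + k) \<partial>l) = (\<integral>\<^sup>+x. f x \<partial>l)"
proof -
  have "distr l l (\<lambda>x. x + k) = l"
  proof (rule measure_eqI)
    fix A assume "A \<in> sets (distr l l (\<lambda>x. x + k))"
    then have A: "A \<in> sets borel" by (simp add: sets_haar)
    have "x \<in> (\<lambda>x. x + - k) ` A" if "x + k \<in> A" for x
      using imageI[OF that, of "\<lambda>x. x + - k"] by (simp add: add.assoc del: add_uminus_conv_diff)
    then have "(\<lambda>x. x + k) -` A = (\<lambda>x. x + - k) ` A"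
      by (auto simp: add.assoc simp del: add_uminus_conv_diff)
    then show "emeasure (distr l l (\<lambda>x. x + k)) A = emeasure l A"
      using A right_invariant[OF A, of "- k"] by (simp add: emeasure_distr sets_haar del: add_uminus_conv_diff)
  qed simp
  then have "(\<integral>\<^sup>+x. f x \<partial>l) = (\<integral>\<^sup>+x. f x \<partial>distr l l (\<lambda>x. x + k))" by simp
  also have "\<dots> = (\<integral>\<^sup>+x. f (x + k) \<partial>l)"
    by (rule nn_integral_distr) measurable
  finally show ?thesis by simp
qed

text \<open>
  This is the usual proof that a left invariant measure is unique up to a factor, run for \<open>l\<close> and its
  image under inversion. With \<open>h\<close> the indicator of the window, three translations turn
  \<open>\<integral>\<integral> f(x) h(y)\<close> into \<open>\<integral>\<integral> f(- y) h(x)\<close>. Both contain the finite positive factor \<open>\<integral> h\<close>, which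
  cancels.
\<close>

lemma nn_integral_inverse:
  assumes [measurable]: "f \<in> borel_measurable borel"
  shows "(\<integral>\<^sup>+x. f (- x) \<partial>l) = (\<integral>\<^sup>+x. f x \<partial>l)"
proof -
  interpret sigma_finite_measure l by (rule sigma_finite_haar)
  interpret pair_sigma_finite l l ..
  let ?h = "indicator window :: 'a \<Rightarrow> ennreal"
  let ?c = "emeasure l window"
  have "(\<integral>\<^sup>+x. f x \<partial>l) * ?c = (\<integral>\<^sup>+x. f x * ?c \<partial>l)"
    by (rule nn_integral_multc[symmetric]) measurable
  \<comment> \<open>right translation of \<open>y\<close> by \<open>x\<close>\<close>
  also have "\<dots> = (\<integral>\<^sup>+x. (\<integral>\<^sup>+y. f x * ?h (y + x) \<partial>l) \<partial>l)"
  proof (rule nn_integral_cong)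
    fix x
    have "(\<integral>\<^sup>+y. f x * ?h (y + x) \<partial>l) = (\<integral>\<^sup>+y. f x * ?h y \<partial>l)"
      by (rule nn_integral_right_translate[of "\<lambda>y. f x * ?h y"]) measurable
    also have "\<dots> = f x * ?c"
      by (simp add: nn_integral_cmult sets_haar)
    finally show "f x * ?c = (\<integral>\<^sup>+y. f x * ?h (y + x) \<partial>l)" by simp
  qed
  also have "\<dots> = (\<integral>\<^sup>+y. (\<integral>\<^sup>+x. f x * ?h (y + x) \<partial>l) \<partial>l)"
    by (rule Fubini') measurable
  \<comment> \<open>left translation of \<open>x\<close> by \<open>- y\<close>\<close>
  also have "\<dots> = (\<integral>\<^sup>+y. (\<integral>\<^sup>+x. f (- y + x) * ?h x \<partial>l) \<partial>l)"
  proof (rule nn_integral_cong)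
    fix y
    have "(\<integral>\<^sup>+x. f (- y + x) * ?h (y + (- y + x)) \<partial>l) = (\<integral>\<^sup>+x. f x * ?h (y + x) \<partial>l)"
      by (rule nn_integral_left_translate[of "\<lambda>x. f x * ?h (y + x)"]) measurable
    then show "(\<integral>\<^sup>+x. f x * ?h (y + x) \<partial>l) = (\<integral>\<^sup>+x. f (- y + x) * ?h x \<partial>l)" by simp
  qed
  also have "\<dots> = (\<integral>\<^sup>+x. (\<integral>\<^sup>+y. f (- y + x) * ?h x \<partial>l) \<partial>l)"
    by (rule Fubini') measurable
  \<comment> \<open>left translation of \<open>y\<close> by \<open>x\<close>\<close>
  also have "\<dots> = (\<integral>\<^sup>+x. (\<integral>\<^sup>+y. f (- y) \<partial>l) * ?h x \<partial>l)"
  proof (rule nn_integral_cong)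
    fix x
    have "(\<integral>\<^sup>+y. f (- (x + y) + x) * ?h x \<partial>l) = (\<integral>\<^sup>+y. f (- y + x) * ?h x \<partial>l)"
      by (rule nn_integral_left_translate[of "\<lambda>y. f (- y + x) * ?h x"]) measurable
    moreover have "- (x + y) + x = - y" for y :: 'a
      by (simp add: minus_add add.assoc del: add_uminus_conv_diff)
    ultimately have "(\<integral>\<^sup>+y. f (- y + x) * ?h x \<partial>l) = (\<integral>\<^sup>+y. f (- y) * ?h x \<partial>l)" by simp
    also have "\<dots> = (\<integral>\<^sup>+y. f (- y) \<partial>l) * ?h x"
      by (rule nn_integral_multc) measurable
    finally show "(\<integral>\<^sup>+y. f (- y + x) * ?h x \<partial>l) = (\<integral>\<^sup>+y. f (- y) \<partial>l) * ?h x" .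
  qed
  also have "\<dots> = (\<integral>\<^sup>+y. f (- y) \<partial>l) * ?c"
    by (simp add: nn_integral_cmult sets_haar)
  finally have "(\<integral>\<^sup>+x. f x \<partial>l) * ?c = (\<integral>\<^sup>+y. f (- y) \<partial>l) * ?c" .
  then show ?thesis
    using emeasure_window_nonzero emeasure_window_finite
    by (simp add: mult.commute[of _ ?c] ennreal_mult_cancel_left)
qed

end

section \<open>Weights on the cosets of a subgroup\<close>

text \<open>
  The finite subgroups go to the branch that the convention selects, so this is the condition under
  which \<open>coset_measure\<close> is a plain push forward.
\<close>

definition treated_as_compact :: "finite_convention \<Rightarrow> 'a::topological_group_add set \<Rightarrow> bool" where
  "treated_as_compact c H \<longleftrightarrow> compact H \<and> (discrete H \<longrightarrow> c = Finite_As_Compact)"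

text \<open>
  A weight for \<open>H\<close> is a density on the group that turns Haar measure into the coset measure: pushing
  \<open>w l\<close> forward along \<open>g \<mapsto> H + g\<close> gives \<open>\<nu>\<^sub>H\<close>. In the discrete case \<open>w\<close> has to distribute total mass
  \<open>1\<close> over each coset; in the compact case no correction is made. Subgroups of neither kind
  carry the zero measure, hence the zero weight.
\<close>

definition coset_weight ::
    "finite_convention \<Rightarrow> 'a::topological_group_add set \<Rightarrow> ('a \<Rightarrow> ennreal) \<Rightarrow> bool" where
  "coset_weight c H w \<longleftrightarrow> w \<in> borel_measurable borel \<and>
     (if treated_as_compact c H then \<forall>g. w g = 1
      else if discrete H then \<forall>g. (\<integral>\<^sup>+h. w (h + g) \<partial>count_space H) = 1
      else \<forall>g. w g = 0)"

lemma treated_as_compact_conjugate: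
  "H \<in> Sub \<Longrightarrow> treated_as_compact c (conjugate k H) \<longleftrightarrow> treated_as_compact c H"
  by (simp add: treated_as_compact_def compact_conjugate discrete_conjugate)

lemma coset_weight_right_translate:
  fixes w :: "'a::{topological_group_add, second_countable_topology} \<Rightarrow> ennreal"
  assumes "coset_weight c H w"
  shows "coset_weight c H (\<lambda>g. w (g + k))"
proof -
  have [measurable]: "w \<in> borel_measurable borel"
    using assms by (simp add: coset_weight_def)
  have "(\<lambda>g. w (g + k)) \<in> borel_measurable borel"
    by measurable
  then show ?thesis
    using assms by (auto simp: coset_weight_def add.assoc split: if_splits)
qed

lemma bij_betw_conjugate: "bij_betw (\<lambda>h. k + h - k) H (conjugate k H)"
  unfolding bij_betw_def conjugate_def
  by (auto intro!: inj_onI simp: diff_conv_add_uminus simp del: add_uminus_conv_diff)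

lemma coset_weight_left_translate:
  fixes w :: "'a::{topological_group_add, second_countable_topology} \<Rightarrow> ennreal"
  assumes H: "H \<in> Sub" and w: "coset_weight c H w"
  shows "coset_weight c (conjugate k H) (\<lambda>g. w (- k + g))"
proof -
  have [measurable]: "w \<in> borel_measurable borel"
    using w by (simp add: coset_weight_def)
  have "(\<lambda>g. w (- k + g)) \<in> borel_measurable borel"
    by measurable
  moreover have "(\<integral>\<^sup>+h. w (- k + (h + g)) \<partial>count_space (conjugate k H)) =
      (\<integral>\<^sup>+h. w (h + (- k + g)) \<partial>count_space H)" for g
  proof -
    have "(\<integral>\<^sup>+h. w (- k + (h + g)) \<partial>count_space (conjugate k H)) =
      (\<integral>\<^sup>+h. w (- k + ((k + h - k) + g)) \<partial>count_space H)"
      by (rule nn_integral_bij_count_space[OF bij_betw_conjugate, symmetric])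
    also have "\<dots> = (\<integral>\<^sup>+h. w (h + (- k + g)) \<partial>count_space H)"
      by (simp add: diff_conv_add_uminus add.assoc del: add_uminus_conv_diff)
    finally show ?thesis .
  qed
  ultimately show ?thesis
    using w by (auto simp: coset_weight_def treated_as_compact_conjugate[OF H] discrete_conjugate[OF H] split: if_splits)
qed

text \<open>
  The total mass of \<open>g \<mapsto> W (- g + H + g) (- g)\<close> over the coset \<open>H + g\<close> is the total mass of
  \<open>W (- g + H + g)\<close> over the coset \<open>- (H + g)\<close> of the conjugate. Elements of the same coset of \<open>H\<close> give
  the same conjugate, so a single weight is summed.
\<close>

lemma coset_weight_inverse:
  fixes W :: "'a::{topological_group_add, second_countable_topology} set \<Rightarrow> 'a \<Rightarrow> ennreal"
  assumes H: "H \<in> Sub" and W: "\<And>H. H \<in> Sub \<Longrightarrow> coset_weight c H (W H)"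
    and meas: "(\<lambda>g. W (conjugate (- g) H) (- g)) \<in> borel_measurable borel"
  shows "coset_weight c H (\<lambda>g. W (conjugate (- g) H) (- g))"
proof -
  have W': "coset_weight c (conjugate (- g) H) (W (conjugate (- g) H))" for g
    by (rule W[OF conjugate_in_Sub[OF H]])
  have shift: "(\<integral>\<^sup>+h. W (conjugate (- (h + g)) H) (- (h + g)) \<partial>count_space H) =
      (\<integral>\<^sup>+h. W (conjugate (- g) H) (h + - g) \<partial>count_space (conjugate (- g) H))" for g
  proof -
    have conj: "conjugate (- (h + g)) H = conjugate (- g) H" if h: "h \<in> H" for h
    proof -
      have "x \<in> conjugate (- h) H \<longleftrightarrow> x \<in> H" for x
      proof -
        have "h + x - h \<in> H" if "x \<in> H"
          using Sub_diff[OF H Sub_add[OF H h that] h] .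
        moreover have "- h + (h + x - h) + h \<in> H" if "h + x - h \<in> H"
          by (intro Sub_add[OF H] Sub_uminus[OF H] h that)
        ultimately show ?thesis
          by (auto simp: mem_conjugate diff_conv_add_uminus add.assoc simp del: add_uminus_conv_diff)
      qed
      then have "conjugate (- h) H = H" by blast
      then show ?thesis
        by (metis conjugate_conjugate minus_add)
    qed
    have "bij_betw uminus H H"
      by (rule bij_betw_byWitness[where f'=uminus]) (auto simp: Sub_uminus[OF H])
    from bij_betw_trans[OF this bij_betw_conjugate[of "- g" H]]
    have bij: "bij_betw (\<lambda>h. - g + (- h) + g) H (conjugate (- g) H)"
      by (simp add: comp_def)
    have "(\<integral>\<^sup>+h. W (conjugate (- (h + g)) H) (- (h + g)) \<partial>count_space H) =
      (\<integral>\<^sup>+h. W (conjugate (- g) H) ((- g + (- h) + g) + - g) \<partial>count_space H)"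
      by (intro nn_integral_cong) (simp add: conj del: add_uminus_conv_diff, simp add: minus_add add.assoc del: add_uminus_conv_diff)
    also have "\<dots> = (\<integral>\<^sup>+h. W (conjugate (- g) H) (h + - g) \<partial>count_space (conjugate (- g) H))"
      by (rule nn_integral_bij_count_space[OF bij])
    finally show ?thesis .
  qed
  have W'': "if treated_as_compact c H then \<forall>x. W (conjugate (- g) H) x = 1
      else if discrete H then \<forall>x. (\<integral>\<^sup>+h. W (conjugate (- g) H) (h + x) \<partial>count_space (conjugate (- g) H)) = 1
      else \<forall>x. W (conjugate (- g) H) x = 0" for g
    using W'[of g] unfolding coset_weight_def treated_as_compact_conjugate[OF H] discrete_conjugate[OF H] by (rule conjunct2)
  show ?thesis
    unfolding coset_weight_def shift
    using W'' meas by (auto simp del: add_uminus_conv_diff split: if_splits)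
qed

text \<open>
  The value is arbitrary unless some basic open set meets \<open>C\<close> in exactly one point, which happens for
  the cosets of a discrete subgroup.
\<close>

definition first_isolating :: "'a::second_countable_topology set \<Rightarrow> nat" where
  "first_isolating C = (LEAST n. is_singleton (C \<inter> basic_open n))"

text \<open>
  For a discrete \<open>H\<close> that is not treated as compact, this is the indicator of a Borel transversal: from each coset \<open>C\<close> it picks the
  point that is isolated by the first basic open set doing so. The choice depends on \<open>C\<close> alone, which
  makes the weight jointly measurable in \<open>H\<close> and \<open>g\<close>.
\<close>

definition transversal_weight ::
    "finite_convention \<Rightarrow> 'a::{topological_group_add, second_countable_topology} set \<Rightarrow> 'a \<Rightarrow> ennreal" where
  "transversal_weight c H g =
     (if treated_as_compact c H then 1
      else if discrete H \<and> g \<in> basic_open (first_isolating (right_coset H g)) then 1 else 0)"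



lemma measurable_transversal_weight:
  assumes lc: "locally_compact_space (euclidean :: 'a::{topological_group_add, t2_space, second_countable_topology} topology)"
  shows "(\<lambda>(H, g). transversal_weight c H g) \<in> borel_measurable (fell_borel (Sub :: 'a set set) \<Otimes>\<^sub>M borel)"
proof -
  let ?M = "fell_borel (Sub :: 'a set set) \<Otimes>\<^sub>M (borel :: 'a measure)"
  have compact [measurable]: "Measurable.pred (fell_borel (Sub :: 'a set set)) compact"
    using sets_compact_subgroups[OF lc] unfolding pred_def by simp
  have discrete [measurable]: "Measurable.pred (fell_borel (Sub :: 'a set set)) discrete"
    using sets_discrete_subgroups unfolding pred_def by simp
  have isolated [measurable]: "Measurable.pred (fell_borel (Cos :: 'a set set)) (\<lambda>C. is_singleton (C \<inter> basic_open n))" for n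
    unfolding pred_def space_fell_borel_Cos by (rule sets_isolated[OF closed_Cos])
  have [measurable]: "(\<lambda>z. right_coset (fst z) (snd z)) \<in> measurable ?M (fell_borel Cos)"
    using measurable_right_coset by (simp add: case_prod_unfold)
  have [measurable]: "(first_isolating :: 'a set \<Rightarrow> nat) \<in> measurable (fell_borel Cos) (count_space UNIV)"
    unfolding first_isolating_def by measurable
  have [measurable]: "Measurable.pred borel (\<lambda>g :: 'a. g \<in> basic_open n)" for n
    using borel_open[OF open_basic_open[of n]] unfolding pred_def by simp
  have "(\<lambda>z. if treated_as_compact c (fst z) then 1
      else if discrete (fst z) \<and> (\<exists>n. first_isolating (right_coset (fst z) (snd z)) = n \<and> snd z \<in> basic_open n) then 1 else 0 :: ennreal)
    \<in> borel_measurable ?M"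
    unfolding treated_as_compact_def by measurable
  then show ?thesis
    by (simp add: transversal_weight_def case_prod_unfold cong: if_cong)
qed

lemma coset_weight_transversal_weight:
  fixes H :: "'a::{topological_group_add, t2_space, second_countable_topology} set"
  assumes lc: "locally_compact_space (euclidean :: 'a topology)" and H: "H \<in> Sub"
  shows "coset_weight c H (transversal_weight c H)"
proof -
  have "(\<lambda>g. (\<lambda>(H, g). transversal_weight c H g) (H, g)) \<in> borel_measurable borel"
    using H by (intro measurable_compose[OF _ measurable_transversal_weight[OF lc]] measurable_Pair1') simp
  moreover have "(\<integral>\<^sup>+h. transversal_weight c H (h + g) \<partial>count_space H) = 1"
    if "\<not> treated_as_compact c H" "discrete H" for g
  proof -
    let ?B = "basic_open (first_isolating (right_coset H g))"
    have "is_singleton (right_coset H g \<inter> ?B)"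
      unfolding first_isolating_def by (rule LeastI_ex[OF discrete_coset_isolated[OF H that(2)]])
    then obtain x where x: "right_coset H g \<inter> ?B = {x}"
      by (rule is_singletonE)
    then have x': "x - g \<in> H" "x \<in> ?B"
      by (auto simp: mem_right_coset)
    have "transversal_weight c H (h + g) = indicator {x - g} h" if h: "h \<in> H" for h
    proof -
      have "right_coset H (h + g) = right_coset H g"
        using h by (simp add: right_coset_eq_iff[OF H])
      moreover have "h + g \<in> ?B \<longleftrightarrow> h = x - g"
      proof
        assume "h + g \<in> ?B"
        then have "h + g \<in> right_coset H g \<inter> ?B"
          using h by (simp add: mem_right_coset)
        then have "h + g = x" unfolding x by simp
        then show "h = x - g" by (simp flip: \<open>h + g = x\<close>)
      qed (use x' in simp)
      ultimately show ?thesis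
        using \<open>\<not> treated_as_compact c H\<close> \<open>discrete H\<close>
        by (simp add: transversal_weight_def)
    qed
    then have "(\<integral>\<^sup>+h. transversal_weight c H (h + g) \<partial>count_space H) =
        (\<integral>\<^sup>+h. indicator {x - g} h \<partial>count_space H)"
      by (intro nn_integral_cong) simp
    also have "\<dots> = 1"
      using x' by simp
    finally show ?thesis .
  qed
  ultimately show ?thesis
    by (simp add: coset_weight_def) (simp add: transversal_weight_def)
qed

section \<open>The coset measures through weights\<close>

text \<open>
  On a sheet \<open>V\<close> the definition prescribes the measure of every subset of the image of \<open>V\<close>, and
  countably many such images cover the coset space. Cutting a set along them determines its measure.
\<close>

lemma local_push_forward_unique:
  fixes l :: "'a::{topological_group_add, t2_space, second_countable_topology} measure"
  assumes H: "H \<in> Sub" "discrete H" and m: "local_push_forward l H m" and n: "local_push_forward l H n"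
  shows "m = n"
proof (rule measure_eqI)
  have sets: "sets m = sets (fell_borel (right_cosets H))" "sets n = sets (fell_borel (right_cosets H))"
    using m n by (simp_all add: local_push_forward_def right_cosets_topology_def)
  then have space: "space m = right_cosets H" "space n = right_cosets H"
    using space_fell_borel_right_cosets[OF H(1)] sets_eq_imp_space_eq by blast+
  show "sets m = sets n" using sets by simp
  define J where "J = {i. \<forall>x\<in>(basic_open i :: 'a set). \<forall>y\<in>basic_open i. x - y \<in> H \<longrightarrow> x = y}"
  define U where "U i = (if i \<in> J then right_coset H ` basic_open i else {})" for i
  have U: "U i \<in> sets (fell_borel (right_cosets H))" for i
    using open_image_right_coset[OF H(1) open_basic_open[of i]]
    by (auto simp: U_def sets_borel_of right_cosets_topology_def)
  have Um: "U i \<inter> space m \<in> sets m" and Un: "U i \<inter> space n \<in> sets n" for i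
    using U[of i] sets by (auto intro!: sets.Int)
  have agree: "emeasure m B = emeasure n B" if B: "B \<in> sets m" "B \<subseteq> U i" for B i
  proof (cases "i \<in> J")
    case True
    let ?Vs = "(\<lambda>h. (\<lambda>x. h + x) ` basic_open i) ` H"
    have "evenly_covered_by H (U i) ?Vs"
      using evenly_covered_image[OF H(1) open_basic_open[of i]] True by (simp add: U_def J_def)
    moreover have "basic_open i \<in> ?Vs"
      using Sub_zero[OF H(1)] by force
    ultimately have restrict:
      "restrict_space m (U i) = distr (restrict_space l (basic_open i)) (restrict_space m (U i)) (right_coset H)"
      "restrict_space n (U i) = distr (restrict_space l (basic_open i)) (restrict_space n (U i)) (right_coset H)"
      using m n unfolding local_push_forward_def by blast+
    have "emeasure m B = emeasure (restrict_space m (U i)) B"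
      by (rule emeasure_restrict_space[OF Um B(2), symmetric])
    also have "\<dots> = emeasure (distr (restrict_space l (basic_open i)) (restrict_space m (U i)) (right_coset H)) B"
      using restrict(1) by simp
    also have "\<dots> = emeasure (distr (restrict_space l (basic_open i)) (restrict_space n (U i)) (right_coset H)) B"
      using sets by (intro arg_cong2[where f=emeasure] distr_cong refl) (simp add: sets_restrict_space)
    also have "\<dots> = emeasure (restrict_space n (U i)) B"
      using restrict(2) by simp
    also have "\<dots> = emeasure n B"
      by (rule emeasure_restrict_space[OF Un B(2)])
    finally show ?thesis .
  qed (use B in \<open>auto simp: U_def\<close>)
  have cover: "right_cosets H \<subseteq> (\<Union>i. U i)"
  proof
    fix C assume "C \<in> right_cosets H"
    then obtain g where g: "C = right_coset H g" by (auto simp: right_cosets_def)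
    obtain i where "g \<in> basic_open i" "i \<in> J"
      using discrete_subgroup_separating_basic_open[OF H, of g] by (auto simp: J_def)
    then show "C \<in> (\<Union>i. U i)"
      using g by (auto simp: U_def)
  qed
  fix A assume A: "A \<in> sets m"
  define D where "D i = A \<inter> disjointed U i" for i
  have "range (disjointed U) \<subseteq> sets m"
    using U sets by (intro sets.range_disjointed_sets) auto
  then have D: "D i \<in> sets m" for i
    using A unfolding D_def by (intro sets.Int) auto
  have "A \<subseteq> right_cosets H"
    using sets.sets_into_space[OF A] space by simp
  then have A_eq: "A = (\<Union>i. D i)"
    using cover UN_disjointed_eq[of U] by (auto simp: D_def)
  have disj: "disjoint_family D"
    using disjoint_family_disjointed[of U] unfolding D_def disjoint_family_on_def by blast
  have "emeasure m (D i) = emeasure n (D i)" for i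
    by (rule agree[OF D, of i i]) (use disjointed_subset[of U i] in \<open>auto simp: D_def\<close>)
  then have "(\<Sum>i. emeasure m (D i)) = (\<Sum>i. emeasure n (D i))" by simp
  then show "emeasure m A = emeasure n A"
    unfolding A_eq using D sets disj by (subst (asm) (1 2) suminf_emeasure) auto
qed

context unimodular_haar
begin

text \<open>
  Unfolding: \<open>\<integral> w(g) \<Sum>\<^sub>h f(h + g) dg = \<Sum>\<^sub>h \<integral> w(- h + g) f(g) dg = \<integral> f(g) \<Sum>\<^sub>h w(- h + g) dg\<close>, and the
  last sum is \<open>1\<close>. The sums range over the countable group \<open>H\<close>.
\<close>

lemma nn_integral_unfold:
  assumes H: "H \<in> Sub" "discrete H"
    and [measurable]: "w \<in> borel_measurable borel" "f \<in> borel_measurable borel"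
    and w: "\<And>g. (\<integral>\<^sup>+h. w (h + g) \<partial>count_space H) = 1"
  shows "(\<integral>\<^sup>+g. w g * (\<integral>\<^sup>+h. f (h + g) \<partial>count_space H) \<partial>l) = (\<integral>\<^sup>+g. f g \<partial>l)"
proof -
  have cH: "countable H" by (rule countable_discrete[OF H(2)])
  interpret l: sigma_finite_measure l by (rule sigma_finite_haar)
  interpret H: sigma_finite_measure "count_space H" by (rule sigma_finite_measure_count_space_countable[OF cH])
  interpret pair_sigma_finite "count_space H" l ..
  have "(\<integral>\<^sup>+g. w g * (\<integral>\<^sup>+h. f (h + g) \<partial>count_space H) \<partial>l) =
      (\<integral>\<^sup>+g. (\<integral>\<^sup>+h. w g * f (h + g) \<partial>count_space H) \<partial>l)"
    by (simp add: nn_integral_cmult)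
  also have "\<dots> = (\<integral>\<^sup>+h. (\<integral>\<^sup>+g. w g * f (h + g) \<partial>l) \<partial>count_space H)"
    by (rule Fubini') (rule measurable_pair_measure_countable1[OF cH], simp only: case_prod_conv, measurable)
  also have "\<dots> = (\<integral>\<^sup>+h. (\<integral>\<^sup>+g. w (- h + g) * f g \<partial>l) \<partial>count_space H)"
  proof (rule nn_integral_cong)
    fix h
    have "(\<integral>\<^sup>+g. w (- h + g) * f (h + (- h + g)) \<partial>l) = (\<integral>\<^sup>+g. w g * f (h + g) \<partial>l)"
      by (rule nn_integral_left_translate[of "\<lambda>g. w g * f (h + g)"]) measurable
    then show "(\<integral>\<^sup>+g. w g * f (h + g) \<partial>l) = (\<integral>\<^sup>+g. w (- h + g) * f g \<partial>l)" by simp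
  qed
  also have "\<dots> = (\<integral>\<^sup>+g. (\<integral>\<^sup>+h. w (- h + g) * f g \<partial>count_space H) \<partial>l)"
    by (rule Fubini'[symmetric]) (rule measurable_pair_measure_countable1[OF cH], simp only: case_prod_conv, measurable)
  also have "\<dots> = (\<integral>\<^sup>+g. f g \<partial>l)"
  proof (rule nn_integral_cong)
    fix g
    have "bij_betw uminus H H"
      by (rule bij_betw_byWitness[where f'=uminus]) (auto simp: Sub_uminus[OF H(1)])
    then have "(\<integral>\<^sup>+h. w (- h + g) \<partial>count_space H) = (\<integral>\<^sup>+h. w (h + g) \<partial>count_space H)"
      by (rule nn_integral_bij_count_space)
    then show "(\<integral>\<^sup>+h. w (- h + g) * f g \<partial>count_space H) = f g"
      by (simp add: nn_integral_multc w)
  qed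
  finally show ?thesis .
qed

text \<open>
  For \<open>A\<close> inside an evenly covered set with sheet \<open>V\<close>, let \<open>P\<close> be the preimage of \<open>A\<close>. Each point of
  \<open>P\<close> has exactly one translate by \<open>H\<close> in \<open>P \<inter> V\<close>, so the indicator of \<open>P\<close> is the sum over \<open>H\<close> of the
  translated indicators of \<open>P \<inter> V\<close>, and unfolding turns \<open>\<integral> w 1\<^sub>P\<close> into the measure of \<open>P \<inter> V\<close>.
\<close>

lemma local_push_forward_weight:
  assumes H: "H \<in> Sub" "discrete H"
    and [measurable]: "w \<in> borel_measurable borel"
    and w: "\<And>g. (\<integral>\<^sup>+h. w (h + g) \<partial>count_space H) = 1"
  shows "local_push_forward l H (distr (density l w) (fell_borel (right_cosets H)) (right_coset H))"
    (is "local_push_forward l H ?n")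
  unfolding local_push_forward_def
proof (intro conjI allI impI ballI)
  note [measurable] = measurable_right_coset_fixed[OF H(1)]
  show "sets ?n = sets (borel_of (right_cosets_topology H))"
    by (simp add: right_cosets_topology_def)
  have space: "space ?n = right_cosets H"
    by (simp add: space_fell_borel_right_cosets[OF H(1)])
  fix U Vs V assume cov: "evenly_covered_by H U Vs" and V: "V \<in> Vs"
  have openU: "openin (right_cosets_topology H) U" and openV: "open V" and
    homeo: "homeomorphic_map (top_of_set V) (subtopology (right_cosets_topology H) U) (right_coset H)"
    using cov V by (auto simp: evenly_covered_by_def)
  have U: "U \<in> sets ?n"
    using openU by (simp add: sets_borel_of right_cosets_topology_def)
  then have U': "U \<subseteq> right_cosets H" "U \<inter> space ?n \<in> sets ?n"
    using sets.sets_into_space[OF U] space by (auto simp: Int_absorb2)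
  have bij: "inj_on (right_coset H) V" "right_coset H ` V = U"
    using homeomorphic_imp_injective_map[OF homeo] homeomorphic_imp_surjective_map[OF homeo] U'(1)
    by (auto simp: topspace_right_cosets_topology[OF H(1)])
  have meas: "right_coset H \<in> measurable (restrict_space l V) (restrict_space ?n U)"
    using bij(2) by (intro measurable_restrict_space3) auto
  show "restrict_space ?n U = distr (restrict_space l V) (restrict_space ?n U) (right_coset H)"
  proof (rule measure_eqI)
    fix A assume "A \<in> sets (restrict_space ?n U)"
    then have A: "A \<subseteq> U" "A \<in> sets ?n" and A': "A \<in> sets (restrict_space ?n U)"
      using sets_restrict_space_iff[OF U'(2)] by auto
    let ?P = "right_coset H -` A"
    have P [measurable]: "?P \<in> sets borel"
      using measurable_sets[OF measurable_right_coset_fixed[OF H(1)], of A] A(2) by simp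
    have [measurable]: "V \<in> sets borel" using openV by simp
    have "emeasure (restrict_space ?n U) A = emeasure ?n A"
      by (rule emeasure_restrict_space[OF U'(2) A(1)])
    also have "\<dots> = emeasure (density l w) ?P"
      using A(2) by (subst emeasure_distr) auto
    also have "\<dots> = (\<integral>\<^sup>+g. w g * indicator ?P g \<partial>l)"
      by (rule emeasure_density) (simp_all add: sets_haar)
    also have "\<dots> = (\<integral>\<^sup>+g. w g * (\<integral>\<^sup>+h. indicator (?P \<inter> V) (h + g) \<partial>count_space H) \<partial>l)"
    proof (intro nn_integral_cong arg_cong2[where f="(*)"] refl)
      fix g
      have shift: "right_coset H (h + g) = right_coset H g" if "h \<in> H" for h
        using that by (simp add: right_coset_eq_iff[OF H(1)])
      show "indicator ?P g = (\<integral>\<^sup>+h. indicator (?P \<inter> V) (h + g) \<partial>count_space H :: ennreal)"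
      proof (cases "right_coset H g \<in> A")
        case True
        then have "right_coset H g \<in> right_coset H ` V" using A(1) bij(2) by blast
        then obtain v where v: "v \<in> V" "right_coset H g = right_coset H v" by blast
        then have vg: "v - g \<in> H"
          using right_coset_eq_iff[OF H(1), of v g] by simp
        have "h + g \<in> V \<longleftrightarrow> h = v - g" if h: "h \<in> H" for h
        proof
          assume "h + g \<in> V"
          then have "h + g = v"
            using inj_onD[OF bij(1), of "h + g" v] shift[OF h] v by simp
          then show "h = v - g" by (simp flip: \<open>h + g = v\<close>)
        qed (use v in simp)
        then have "(\<integral>\<^sup>+h. indicator (?P \<inter> V) (h + g) \<partial>count_space H :: ennreal) =
           (\<integral>\<^sup>+h. indicator {v - g} h \<partial>count_space H)"
          using True shift by (intro nn_integral_cong) (auto simp: indicator_def)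
        also have "\<dots> = 1" using vg by simp
        finally show ?thesis using True by simp
      next
        case False
        then have "(\<integral>\<^sup>+h. indicator (?P \<inter> V) (h + g) \<partial>count_space H :: ennreal) = (\<integral>\<^sup>+h. 0 \<partial>count_space H)"
          using shift by (intro nn_integral_cong) (auto simp: indicator_def)
        then show ?thesis using False by simp
      qed
    qed
    also have "\<dots> = (\<integral>\<^sup>+g. indicator (?P \<inter> V) g \<partial>l)"
      by (rule nn_integral_unfold[OF H _ _ w]) measurable
    also have "\<dots> = emeasure l (?P \<inter> V)"
      by (rule nn_integral_indicator) (simp add: sets_haar)
    also have "\<dots> = emeasure (restrict_space l V) (?P \<inter> V)"
      by (rule emeasure_restrict_space[symmetric]) (simp_all add: sets_haar)
    also have "\<dots> = emeasure (distr (restrict_space l V) (restrict_space ?n U) (right_coset H)) A"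
      by (subst emeasure_distr[OF meas A']) (simp add: space_restrict_space)
    finally show "emeasure (restrict_space ?n U) A =
        emeasure (distr (restrict_space l V) (restrict_space ?n U) (right_coset H)) A" .
  qed simp
qed

text \<open>
  For discrete \<open>H\<close> the push forwards of \<open>w l\<close> for all weights \<open>w\<close> are local push forwards of \<open>l\<close>, hence
  they coincide by uniqueness. Both directions of the theorem replace one weight by
  another in this way.
\<close>

lemma nn_integral_coset_measure:
  assumes H: "H \<in> Sub" and w: "coset_weight c H w"
    and F: "F \<in> borel_measurable (fell_borel (right_cosets H))"
  shows "(\<integral>\<^sup>+C. F C \<partial>coset_measure c l H) = (\<integral>\<^sup>+g. w g * F (right_coset H g) \<partial>l)"
proof -
  note [measurable] = measurable_right_coset_fixed[OF H] F
  have [measurable]: "w \<in> borel_measurable borel"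
    using w by (simp add: coset_weight_def)
  consider (compact) "treated_as_compact c H" | (discrete) "\<not> treated_as_compact c H" "discrete H"
    | (none) "\<not> treated_as_compact c H" "\<not> discrete H" by blast
  then show ?thesis
  proof cases
    case compact
    then have "coset_measure c l H = distr l (fell_borel (right_cosets H)) (right_coset H)"
      by (simp add: coset_measure_def treated_as_compact_def right_cosets_topology_def)
    moreover have "w g = 1" for g
      using w compact by (simp add: coset_weight_def)
    ultimately show ?thesis
      by (simp add: nn_integral_distr)
  next
    case discrete
    have "(\<integral>\<^sup>+h. w (h + g) \<partial>count_space H) = 1" for g
      using w discrete by (simp add: coset_weight_def)
    then have "local_push_forward l H (distr (density l w) (fell_borel (right_cosets H)) (right_coset H))"
      by (intro local_push_forward_weight H discrete) simp_all
    then have "(THE n. local_push_forward l H n) = distr (density l w) (fell_borel (right_cosets H)) (right_coset H)"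
      using local_push_forward_unique[OF H discrete(2)] by (intro the_equality) blast+
    then have "coset_measure c l H = distr (density l w) (fell_borel (right_cosets H)) (right_coset H)"
      using discrete by (auto simp: coset_measure_def treated_as_compact_def)
    then show ?thesis
      by (simp add: nn_integral_distr nn_integral_density)
  next
    case none
    moreover have "w g = 0" for g
      using w none by (simp add: coset_weight_def)
    ultimately show ?thesis
      by (auto simp: coset_measure_def treated_as_compact_def)
  qed
qed

end

section \<open>From conjugation invariance to the inversion identity\<close>

lemma measurable_right_coset_comp [measurable (raw)]:
  fixes f :: "'b \<Rightarrow> 'a::{topological_group_add, second_countable_topology} set"
  assumes "f \<in> measurable M (fell_borel Sub)" "g \<in> borel_measurable M"
  shows "(\<lambda>x. right_coset (f x) (g x)) \<in> measurable M (fell_borel Cos)"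
  using measurable_compose[OF measurable_Pair[OF assms] measurable_right_coset] by simp

lemma measurable_conjugate_comp [measurable (raw)]:
  fixes f :: "'b \<Rightarrow> 'a::{topological_group_add, second_countable_topology} set"
  assumes "f \<in> measurable M (fell_borel Sub)" "g \<in> borel_measurable M"
  shows "(\<lambda>x. conjugate (g x) (f x)) \<in> measurable M (fell_borel Sub)"
  using measurable_compose[OF measurable_Pair[OF assms(1) borel_measurable_uminus_group[OF assms(2)]]
      measurable_conjugate_pair] by simp

declare measurable_inverse_coset [measurable] measurable_left_coset [measurable] measurable_differences [measurable]

lemma measurable_right_cosets_Cos:
  fixes F :: "'a::{topological_group_add, second_countable_topology} set \<Rightarrow> 'b::topological_space"
  assumes "H \<in> Sub" "F \<in> borel_measurable (fell_borel Cos)"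
  shows "F \<in> borel_measurable (fell_borel (right_cosets H))"
  using measurable_compose[OF measurable_fell_borel_mono[OF right_cosets_subset_Cos[OF assms(1)] closed_Cos] assms(2)]
  by simp

context unimodular_haar
begin

lemma measurable_transversal_weight_comp [measurable (raw)]:
  assumes "f \<in> measurable M (fell_borel Sub)" "g \<in> borel_measurable M"
  shows "(\<lambda>x. transversal_weight c (f x) (g x :: 'a)) \<in> borel_measurable M"
  using measurable_compose[OF measurable_Pair[OF assms] measurable_transversal_weight[OF locally_compact]] by simp

lemmas coset_weight_transversal = coset_weight_transversal_weight[OF locally_compact]

text \<open>
  With \<open>W\<close> the transversal weight, the right side is the double integral of
  \<open>W H g * F (K - g)\<close> with \<open>K = - g + H + g\<close>. For fixed \<open>g\<close>, invariance of \<open>lam\<close> permits to integrate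
  over \<open>K\<close> instead of \<open>H\<close>, and invariance of \<open>l\<close> under inversion replaces \<open>g\<close> by \<open>- g\<close>. What results
  is the integral of \<open>F (K + g)\<close> against \<open>W (- g + K + g) (- g)\<close>, which is another weight for \<open>K\<close>.
\<close>

lemma inversion_identity:
  fixes F :: "'a set \<Rightarrow> ennreal"
  assumes sets_lam [measurable_cong]: "sets lam = sets (fell_borel (Sub :: 'a set set))"
    and "sigma_finite_measure lam" and inv: "conjugation_invariant lam"
    and F [measurable]: "F \<in> borel_measurable (fell_borel Cos)"
  shows "(\<integral>\<^sup>+H. (\<integral>\<^sup>+C. F C \<partial>coset_measure c l H) \<partial>lam) =
    (\<integral>\<^sup>+H. (\<integral>\<^sup>+C. F (inverse_coset C) \<partial>coset_measure c l H) \<partial>lam)"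
proof -
  interpret lam: sigma_finite_measure lam by fact
  interpret l: sigma_finite_measure l by (rule sigma_finite_haar)
  interpret pair_sigma_finite lam l ..
  have space_lam: "space lam = Sub"
    using sets_eq_imp_space_eq[OF sets_lam] by simp
  let ?W = "transversal_weight c"
  define f where "f g = (\<integral>\<^sup>+K. ?W (conjugate (- g) K) (- g) * F (right_coset K g) \<partial>lam)" for g
  have f [measurable]: "f \<in> borel_measurable borel"
    unfolding f_def by measurable
  have "(\<integral>\<^sup>+H. (\<integral>\<^sup>+C. F (inverse_coset C) \<partial>coset_measure c l H) \<partial>lam) =
      (\<integral>\<^sup>+H. (\<integral>\<^sup>+g. ?W H g * F (inverse_coset (right_coset H g)) \<partial>l) \<partial>lam)"
    using space_lam by (intro nn_integral_cong nn_integral_coset_measure coset_weight_transversal measurable_right_cosets_Cos) simp_all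
  also have "\<dots> = (\<integral>\<^sup>+g. (\<integral>\<^sup>+H. ?W H g * F (inverse_coset (right_coset H g)) \<partial>lam) \<partial>l)"
    by (rule Fubini'[symmetric]) measurable
  also have "\<dots> = (\<integral>\<^sup>+g. f (- g) \<partial>l)"
  proof (rule nn_integral_cong)
    fix g :: 'a
    let ?\<Psi> = "\<lambda>K. ?W (conjugate g K) g * F (right_coset K (- g))"
    have "f (- g) = (\<integral>\<^sup>+K. ?\<Psi> K \<partial>distr lam lam (conjugate (- g)))"
      using inv by (simp add: conjugation_invariant_def f_def)
    also have "\<dots> = (\<integral>\<^sup>+H. ?\<Psi> (conjugate (- g) H) \<partial>lam)"
      by (rule nn_integral_distr) measurable
    also have "\<dots> = (\<integral>\<^sup>+H. ?W H g * F (inverse_coset (right_coset H g)) \<partial>lam)"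
      using space_lam by (intro nn_integral_cong) (simp add: conjugate_conjugate inverse_right_coset)
    finally show "(\<integral>\<^sup>+H. ?W H g * F (inverse_coset (right_coset H g)) \<partial>lam) = f (- g)" ..
  qed
  also have "\<dots> = (\<integral>\<^sup>+g. f g \<partial>l)"
    by (rule nn_integral_inverse[OF f])
  also have "\<dots> = (\<integral>\<^sup>+K. (\<integral>\<^sup>+g. ?W (conjugate (- g) K) (- g) * F (right_coset K g) \<partial>l) \<partial>lam)"
    unfolding f_def by (rule Fubini') measurable
  also have "\<dots> = (\<integral>\<^sup>+K. (\<integral>\<^sup>+C. F C \<partial>coset_measure c l K) \<partial>lam)"
  proof (rule nn_integral_cong)
    fix K assume "K \<in> space lam"
    then have K: "K \<in> Sub" and [measurable]: "(\<lambda>_. K) \<in> measurable borel (fell_borel (Sub :: 'a set set))"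
      by (simp_all add: space_lam)
    have "coset_weight c K (\<lambda>g. ?W (conjugate (- g) K) (- g))"
      by (rule coset_weight_inverse[OF K coset_weight_transversal]) measurable
    from nn_integral_coset_measure[OF K this measurable_right_cosets_Cos[OF K F]]
    show "(\<integral>\<^sup>+g. ?W (conjugate (- g) K) (- g) * F (right_coset K g) \<partial>l) = (\<integral>\<^sup>+C. F C \<partial>coset_measure c l K)" ..
  qed
  finally show ?thesis ..
qed

section \<open>From the inversion identity to conjugation invariance\<close>

definition meets_window :: "'a set \<Rightarrow> ennreal" where
  "meets_window C = (if C \<inter> window \<noteq> {} then 1 else 0)"

text \<open>
  Only the cosets that meet the window are counted, because the whole coset space can have infinite
  measure, while this part has positive finite measure for every discrete or compact subgroup.
\<close>

definition window_mass :: "finite_convention \<Rightarrow> 'a set \<Rightarrow> ennreal" where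
  "window_mass c H = (\<integral>\<^sup>+C. meets_window C \<partial>coset_measure c l H)"

lemma pred_window [measurable]: "Measurable.pred (fell_borel (Cos :: 'a set set)) (\<lambda>C. C \<inter> window \<noteq> {})"
  unfolding pred_def space_fell_borel_Cos by (rule sets_fell_borel_hits[OF closed_Cos open_window])

lemma measurable_meets_window [measurable]: "meets_window \<in> borel_measurable (fell_borel Cos)"
  unfolding meets_window_def by measurable

lemma window_mass_eq:
  assumes "H \<in> Sub" "coset_weight c H w"
  shows "window_mass c H = (\<integral>\<^sup>+g. w g * meets_window (right_coset H g) \<partial>l)"
  unfolding window_mass_def
  by (rule nn_integral_coset_measure[OF assms measurable_right_cosets_Cos[OF assms(1) measurable_meets_window]])

lemma measurable_window_mass [measurable]: "window_mass c \<in> borel_measurable (fell_borel Sub)"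
proof -
  interpret l: sigma_finite_measure l by (rule sigma_finite_haar)
  have "(\<lambda>H. \<integral>\<^sup>+g. transversal_weight c H g * meets_window (right_coset H g) \<partial>l) \<in> borel_measurable (fell_borel Sub)"
    by measurable
  then show ?thesis
    by (rule measurable_cong[THEN iffD1, rotated]) (simp add: window_mass_eq[OF _ coset_weight_transversal])
qed

text \<open>
  This is the Haar measure of the set of all \<open>g\<close> for which \<open>H + g\<close> meets the window. That set contains
  the window and lies in the compact set \<open>H + closure window\<close>.
\<close>

lemma window_mass_compact:
  assumes H: "H \<in> Sub" and c: "treated_as_compact c H"
  shows "window_mass c H \<noteq> 0" "window_mass c H \<noteq> top"
proof -
  define T where "T = {g. right_coset H g \<inter> window \<noteq> {}}"
  have T: "T \<in> sets l"
    unfolding T_def sets_haar by (intro borel_open open_vimage_right_coset_hits open_window)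
  have "coset_weight c H (\<lambda>_. 1)"
    using c by (simp add: coset_weight_def)
  from window_mass_eq[OF H this] have "window_mass c H = (\<integral>\<^sup>+g. indicator T g \<partial>l)"
    by (simp add: meets_window_def T_def indicator_def of_bool_def)
  then have mass: "window_mass c H = emeasure l T"
    using T by simp
  have "g \<in> right_coset H g" for g
    using Sub_zero[OF H] by (simp add: mem_right_coset)
  then have "window \<subseteq> T"
    unfolding T_def by blast
  then have "emeasure l window \<le> emeasure l T"
    by (rule emeasure_mono[OF _ T])
  then show "window_mass c H \<noteq> 0"
    using emeasure_window_nonzero by (auto simp: mass)
  let ?K = "(\<lambda>(x, y). x + y) ` (H \<times> closure window)"
  have "compact ?K"
    using c compact_closure_window unfolding case_prod_unfold
    by (intro compact_continuous_image compact_Times continuous_intros) (auto simp: treated_as_compact_def)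
  then have K: "?K \<in> sets l" "emeasure l ?K < \<infinity>"
    using left_haar by (auto simp: sets_haar left_haar_measure_def intro!: borel_closed compact_imp_closed)
  have "T \<subseteq> ?K"
  proof
    fix g assume "g \<in> T"
    then obtain u where u: "u - g \<in> H" "u \<in> window"
      by (auto simp: T_def mem_right_coset)
    have "(- (u - g), u) \<in> H \<times> closure window"
      using Sub_uminus[OF H u(1)] closure_subset[of window] u(2) by auto
    then have "- (u - g) + u \<in> ?K"
      by (rule rev_image_eqI) simp
    then show "g \<in> ?K" by simp
  qed
  then have "emeasure l T \<le> emeasure l ?K"
    by (rule emeasure_mono[OF _ K(1)])
  then show "window_mass c H \<noteq> top"
    using K(2) by (auto simp: mass top_unique)
qed

text \<open>
  Let \<open>N g\<close> be the number of points of \<open>H + g\<close> in the window. By unfolding, its integral over the coset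
  space is the measure of the window. The indicator of \<open>N g > 0\<close> is at most \<open>N g\<close>, which bounds its
  integral, and it vanishes only where \<open>N g\<close> does, which makes its integral positive.
\<close>

lemma window_mass_discrete:
  assumes H: "H \<in> Sub" "discrete H" and c: "\<not> treated_as_compact c H"
  shows "window_mass c H \<noteq> 0" "window_mass c H \<noteq> top"
proof -
  let ?w = "transversal_weight c H"
  define N :: "'a \<Rightarrow> ennreal" where "N g = (\<integral>\<^sup>+h. indicator window (h + g) \<partial>count_space H)" for g
  have [measurable]: "?w \<in> borel_measurable borel" and sum: "(\<integral>\<^sup>+h. ?w (h + g) \<partial>count_space H) = 1" for g
    using coset_weight_transversal[OF H(1), of c] c H(2) by (auto simp: coset_weight_def)
  have unfold: "(\<integral>\<^sup>+g. ?w g * N g \<partial>l) = emeasure l window"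
    unfolding N_def by (subst nn_integral_unfold[OF H _ _ sum]) (simp_all add: sets_haar)
  have mass: "window_mass c H = (\<integral>\<^sup>+g. ?w g * meets_window (right_coset H g) \<partial>l)"
    by (rule window_mass_eq[OF H(1) coset_weight_transversal[OF H(1)]])
  have le: "meets_window (right_coset H g) \<le> N g" for g
  proof (cases "right_coset H g \<inter> window = {}")
    case False
    then obtain h where h: "h \<in> H" "h + g \<in> window"
      by (auto simp: right_coset_def)
    have "1 = (\<integral>\<^sup>+h'. indicator {h} h' \<partial>count_space H)"
      using h by simp
    also have "\<dots> \<le> N g"
      unfolding N_def using h by (intro nn_integral_mono) (auto simp: indicator_def)
    finally show ?thesis by (simp add: meets_window_def)
  qed (simp add: meets_window_def)
  have zero: "N g = 0" if "meets_window (right_coset H g) = 0" for g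
  proof -
    have "h + g \<notin> window" if "h \<in> H" for h
      using that \<open>meets_window (right_coset H g) = 0\<close>
      by (auto simp: meets_window_def right_coset_def split: if_splits)
    then have "N g = (\<integral>\<^sup>+h. 0 \<partial>count_space H)"
      unfolding N_def by (intro nn_integral_cong) simp
    then show ?thesis by simp
  qed
  have "window_mass c H \<le> emeasure l window"
    unfolding mass unfold[symmetric] by (intro nn_integral_mono mult_left_mono le) simp
  then show "window_mass c H \<noteq> top"
    using emeasure_window_finite by (auto simp: top_unique)
  show "window_mass c H \<noteq> 0"
  proof
    have [measurable]: "(\<lambda>_. H) \<in> measurable l (fell_borel (Sub :: 'a set set))"
      using H(1) by simp
    assume "window_mass c H = 0"
    then have "AE g in l. ?w g * meets_window (right_coset H g) = 0"
      unfolding mass by (subst (asm) nn_integral_0_iff_AE) measurable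
    then have "AE g in l. ?w g * N g = 0"
      by eventually_elim (auto simp: zero)
    then have "(\<integral>\<^sup>+g. ?w g * N g \<partial>l) = (\<integral>\<^sup>+g. 0 \<partial>l)"
      by (rule nn_integral_cong_AE)
    then show False
      using unfold emeasure_window_nonzero by simp
  qed
qed

lemma window_mass_nontrivial:
  assumes "H \<in> Sub" "discrete H \<or> compact H"
  shows "window_mass c H \<noteq> 0" "window_mass c H \<noteq> top"
  using window_mass_compact[OF assms(1)] window_mass_discrete[OF assms(1)] assms(2)
  by (cases "treated_as_compact c H"; auto simp: treated_as_compact_def)+

text \<open>
  A function on cosets whose \<open>\<nu>\<^sub>H\<close>-integral, for discrete or compact \<open>H\<close>, is the indicator of
  \<open>H \<in> A\<close>: it reads off \<open>H\<close> as \<open>C - C\<close> and spreads total mass \<open>1\<close> over the cosets that meet the window.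
\<close>

definition detector :: "finite_convention \<Rightarrow> 'a set set \<Rightarrow> 'a set \<Rightarrow> real" where
  "detector c A C = (if differences C \<in> A \<and> C \<inter> window \<noteq> {} then enn2real (1 / window_mass c (differences C)) else 0)"

lemma measurable_detector:
  assumes [measurable]: "A \<in> sets (fell_borel Sub)"
  shows "detector c A \<in> borel_measurable (fell_borel Cos)"
  unfolding detector_def by measurable

lemma detector_nonneg: "0 \<le> detector c A C"
  by (simp add: detector_def)

lemma nn_integral_detector:
  assumes A: "A \<in> sets (fell_borel Sub)" and H: "H \<in> Sub" "discrete H \<or> compact H"
  shows "(\<integral>\<^sup>+C. ennreal (detector c A C) \<partial>coset_measure c l H) = indicator A H"
proof -
  note [measurable] = measurable_detector[OF A]
  note mass = window_mass_nontrivial[OF H, of c]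
  let ?w = "transversal_weight c H"
  have [measurable]: "(\<lambda>_. H) \<in> measurable l (fell_borel (Sub :: 'a set set))"
    using H(1) by simp
  have "1 / window_mass c H \<noteq> top"
    using mass by (simp add: ennreal_divide_eq_top_iff)
  then have "1 / window_mass c H < top"
    by (simp add: less_top)
  then have det: "ennreal (detector c A (right_coset H g)) = indicator A H / window_mass c H * meets_window (right_coset H g)" for g
    by (simp add: detector_def meets_window_def differences_right_coset[OF H(1)] indicator_def)
  have "(\<integral>\<^sup>+C. ennreal (detector c A C) \<partial>coset_measure c l H) =
      (\<integral>\<^sup>+g. ?w g * ennreal (detector c A (right_coset H g)) \<partial>l)"
    by (intro nn_integral_coset_measure coset_weight_transversal measurable_right_cosets_Cos H) measurable
  also have "\<dots> = (\<integral>\<^sup>+g. indicator A H / window_mass c H * (?w g * meets_window (right_coset H g)) \<partial>l)"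
    by (simp add: det ac_simps)
  also have "\<dots> = indicator A H / window_mass c H * window_mass c H"
    unfolding window_mass_eq[OF H(1) coset_weight_transversal[OF H(1)]] by (rule nn_integral_cmult) measurable
  also have "\<dots> = indicator A H"
    using mass ennreal_divide_self[of "window_mass c H"]
    by (simp add: indicator_def ennreal_divide_times less_top)
  finally show ?thesis .
qed

text \<open>
  Left translation by \<open>k\<close> carries cosets of \<open>H\<close> to cosets of \<open>k + H - k\<close>, and it carries weights to
  weights.
\<close>

lemma nn_integral_left_coset:
  fixes F :: "'a set \<Rightarrow> ennreal"
  assumes H: "H \<in> Sub" and F [measurable]: "F \<in> borel_measurable (fell_borel Cos)"
  shows "(\<integral>\<^sup>+C. F (left_coset k C) \<partial>coset_measure c l H) = (\<integral>\<^sup>+C. F C \<partial>coset_measure c l (conjugate k H))"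
proof -
  let ?w = "transversal_weight c H"
  have [measurable]: "(\<lambda>_. H) \<in> measurable borel (fell_borel (Sub :: 'a set set))"
    using H by simp
  have "(\<integral>\<^sup>+C. F (left_coset k C) \<partial>coset_measure c l H) =
      (\<integral>\<^sup>+g. ?w g * F (left_coset k (right_coset H g)) \<partial>l)"
    by (intro nn_integral_coset_measure coset_weight_transversal measurable_right_cosets_Cos H) measurable
  also have "\<dots> = (\<integral>\<^sup>+g. ?w (- k + (k + g)) * F (right_coset (conjugate k H) (k + g)) \<partial>l)"
    by (simp add: left_coset_right_coset)
  also have "\<dots> = (\<integral>\<^sup>+g. ?w (- k + g) * F (right_coset (conjugate k H) g) \<partial>l)"
    by (rule nn_integral_left_translate[of "\<lambda>g. ?w (- k + g) * F (right_coset (conjugate k H) g)"]) measurable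
  also have "\<dots> = (\<integral>\<^sup>+C. F C \<partial>coset_measure c l (conjugate k H))"
    by (intro nn_integral_coset_measure[symmetric] coset_weight_left_translate coset_weight_transversal
        measurable_right_cosets_Cos conjugate_in_Sub H F)
  finally show ?thesis .
qed

text \<open>
  Left translating the inverse of a coset by \<open>k\<close> amounts to right translating the coset by \<open>- k\<close>, and
  \<open>\<nu>\<^sub>H\<close> is invariant under right translations, since the right translate of a weight for \<open>H\<close> is again
  a weight for \<open>H\<close>.
\<close>

lemma nn_integral_left_coset_inverse_coset:
  fixes F :: "'a set \<Rightarrow> ennreal"
  assumes H: "H \<in> Sub" and F [measurable]: "F \<in> borel_measurable (fell_borel Cos)"
  shows "(\<integral>\<^sup>+C. F (left_coset k (inverse_coset C)) \<partial>coset_measure c l H) =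
    (\<integral>\<^sup>+C. F (inverse_coset C) \<partial>coset_measure c l H)"
proof -
  let ?w = "transversal_weight c H"
  have [measurable]: "(\<lambda>_. H) \<in> measurable borel (fell_borel (Sub :: 'a set set))"
    using H by simp
  have "(\<integral>\<^sup>+C. F (left_coset k (inverse_coset C)) \<partial>coset_measure c l H) =
      (\<integral>\<^sup>+g. ?w g * F (left_coset k (inverse_coset (right_coset H g))) \<partial>l)"
    by (intro nn_integral_coset_measure coset_weight_transversal measurable_right_cosets_Cos H) measurable
  also have "\<dots> = (\<integral>\<^sup>+g. ?w (g + - k + k) * F (inverse_coset (right_coset H (g + - k))) \<partial>l)"
    by (simp add: left_coset_inverse_coset)
  also have "\<dots> = (\<integral>\<^sup>+g. ?w (g + k) * F (inverse_coset (right_coset H g)) \<partial>l)"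
    by (rule nn_integral_right_translate[of "\<lambda>g. ?w (g + k) * F (inverse_coset (right_coset H g))"]) measurable
  also have "\<dots> = (\<integral>\<^sup>+C. F (inverse_coset C) \<partial>coset_measure c l H)"
    by (rule nn_integral_coset_measure[symmetric, OF H coset_weight_right_translate[OF coset_weight_transversal[OF H]]
          measurable_right_cosets_Cos[OF H]]) measurable
  finally show ?thesis .
qed

text \<open>
  The measure \<open>m = \<integral> \<nu>\<^sub>H dlam\<close> on cosets is invariant under right translations. If it is also invariant
  under inversion, then it is invariant under left translations. Left translation by \<open>k\<close> conjugates
  the subgroup \<open>C - C\<close> by \<open>k\<close>, and integrating the detector of \<open>A\<close> against \<open>m\<close> gives \<open>lam A\<close>, so
  \<open>lam\<close> is invariant under conjugation.
\<close>

lemma conjugation_invariant_if_inversion_identity: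
  assumes sets_lam [measurable_cong]: "sets lam = sets (fell_borel (Sub :: 'a set set))"
    and AE: "AE H in lam. discrete H \<or> compact H"
    and identity: "\<And>f :: 'a set \<Rightarrow> real. f \<in> borel_measurable (fell_borel Cos) \<Longrightarrow> (\<And>C. 0 \<le> f C) \<Longrightarrow>
       (\<integral>\<^sup>+H. (\<integral>\<^sup>+C. ennreal (f C) \<partial>coset_measure c l H) \<partial>lam) =
       (\<integral>\<^sup>+H. (\<integral>\<^sup>+C. ennreal (f (inverse_coset C)) \<partial>coset_measure c l H) \<partial>lam)"
  shows "conjugation_invariant lam"
  unfolding conjugation_invariant_def
proof (intro allI measure_eqI)
  fix k A assume "A \<in> sets (distr lam lam (conjugate k))"
  then have A [measurable]: "A \<in> sets (fell_borel Sub)" and A': "A \<in> sets lam"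
    by (simp_all add: sets_lam)
  have space_lam: "space lam = Sub"
    using sets_eq_imp_space_eq[OF sets_lam] by simp
  have conj [measurable]: "conjugate k \<in> measurable lam lam"
    using measurable_conjugate_fixed measurable_cong_sets[OF sets_lam sets_lam] by blast
  let ?d = "detector c A"
  note d [measurable] = measurable_detector[OF A, of c]
  have "emeasure (distr lam lam (conjugate k)) A = (\<integral>\<^sup>+K. indicator A K \<partial>distr lam lam (conjugate k))"
    using A' by simp
  also have "\<dots> = (\<integral>\<^sup>+H. indicator A (conjugate k H) \<partial>lam)"
    by (rule nn_integral_distr[OF conj]) (use A' in measurable)
  also have "\<dots> = (\<integral>\<^sup>+H. (\<integral>\<^sup>+C. ennreal (?d (left_coset k C)) \<partial>coset_measure c l H) \<partial>lam)"
  proof (rule nn_integral_cong_AE)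
    show "AE H in lam. indicator A (conjugate k H) = (\<integral>\<^sup>+C. ennreal (?d (left_coset k C)) \<partial>coset_measure c l H)"
      using AE AE_space
    proof eventually_elim
      case (elim H)
      then have H: "H \<in> Sub" "discrete (conjugate k H) \<or> compact (conjugate k H)"
        by (auto simp: space_lam discrete_conjugate compact_conjugate)
      have "(\<integral>\<^sup>+C. ennreal (?d (left_coset k C)) \<partial>coset_measure c l H) =
          (\<integral>\<^sup>+C. ennreal (?d C) \<partial>coset_measure c l (conjugate k H))"
        by (rule nn_integral_left_coset[OF H(1), of "\<lambda>C. ennreal (?d C)"]) measurable
      then show ?case
        using nn_integral_detector[OF A conjugate_in_Sub[OF H(1)] H(2)] by simp
    qed
  qed
  also have "\<dots> = (\<integral>\<^sup>+H. (\<integral>\<^sup>+C. ennreal (?d (left_coset k (inverse_coset C))) \<partial>coset_measure c l H) \<partial>lam)"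
    by (rule identity) (simp_all add: detector_nonneg)
  also have "\<dots> = (\<integral>\<^sup>+H. (\<integral>\<^sup>+C. ennreal (?d (inverse_coset C)) \<partial>coset_measure c l H) \<partial>lam)"
    using space_lam
    by (intro nn_integral_cong nn_integral_left_coset_inverse_coset[of _ "\<lambda>C. ennreal (?d C)"]) simp_all
  also have "\<dots> = (\<integral>\<^sup>+H. (\<integral>\<^sup>+C. ennreal (?d C) \<partial>coset_measure c l H) \<partial>lam)"
    by (rule identity[symmetric]) (simp_all add: detector_nonneg d)
  also have "\<dots> = (\<integral>\<^sup>+H. indicator A H \<partial>lam)"
  proof (rule nn_integral_cong_AE)
    show "AE H in lam. (\<integral>\<^sup>+C. ennreal (?d C) \<partial>coset_measure c l H) = indicator A H"
      using AE AE_space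
      by eventually_elim (rule nn_integral_detector[OF A], simp_all add: space_lam)
  qed
  also have "\<dots> = emeasure lam A"
    using A' by simp
  finally show "emeasure (distr lam lam (conjugate k)) A = emeasure lam A" .
qed simp

end

section \<open>The equivalence\<close>

theorem theorem1p4:
  fixes l :: "'a::{topological_group_add, t2_space, second_countable_topology} measure"
    and lam :: "'a set measure"
    and c :: finite_convention
  assumes "locally_compact_space (euclidean :: 'a topology)"
    and "unimodular_group TYPE('a)"
    and "left_haar_measure l"
    and "sets lam = sets (borel_of chabauty_topology)"
    and "sigma_finite_measure lam"
    and "AE H in lam. discrete H \<or> compact H"
  shows "conjugation_invariant lam \<longleftrightarrow>
    (\<forall>f :: 'a set \<Rightarrow> real. f \<in> borel_measurable (borel_of cos_topology) \<longrightarrow>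
       (\<forall>C\<in>Cos. 0 \<le> f C) \<longrightarrow>
       (\<integral>\<^sup>+ H. (\<integral>\<^sup>+ C. ennreal (f C) \<partial>coset_measure c l H) \<partial>lam) =
       (\<integral>\<^sup>+ H. (\<integral>\<^sup>+ C. ennreal (f (inverse_coset C)) \<partial>coset_measure c l H) \<partial>lam))"
proof -
  interpret unimodular_haar l
    using assms(1-3) by unfold_locales (auto simp: unimodular_group_def)
  have sets_lam: "sets lam = sets (fell_borel Sub)"
    using assms(4) by (simp add: fell_borel_Sub)
  show ?thesis
  proof (intro iffI allI impI)
    fix f :: "'a set \<Rightarrow> real"
    assume "conjugation_invariant lam" "f \<in> borel_measurable (borel_of cos_topology)"
    then show "(\<integral>\<^sup>+ H. (\<integral>\<^sup>+ C. ennreal (f C) \<partial>coset_measure c l H) \<partial>lam) =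
       (\<integral>\<^sup>+ H. (\<integral>\<^sup>+ C. ennreal (f (inverse_coset C)) \<partial>coset_measure c l H) \<partial>lam)"
      by (intro inversion_identity[OF sets_lam assms(5), of "\<lambda>C. ennreal (f C)"])
         (simp_all add: fell_borel_Cos)
  next
    assume "\<forall>f :: 'a set \<Rightarrow> real. f \<in> borel_measurable (borel_of cos_topology) \<longrightarrow>
       (\<forall>C\<in>Cos. 0 \<le> f C) \<longrightarrow>
       (\<integral>\<^sup>+ H. (\<integral>\<^sup>+ C. ennreal (f C) \<partial>coset_measure c l H) \<partial>lam) =
       (\<integral>\<^sup>+ H. (\<integral>\<^sup>+ C. ennreal (f (inverse_coset C)) \<partial>coset_measure c l H) \<partial>lam)"
    then show "conjugation_invariant lam"
      by (intro conjugation_invariant_if_inversion_identity[OF sets_lam assms(6), of c])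
         (simp add: fell_borel_Cos)
  qed
qed

end
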